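(* For every fixed integer $d\ge 0$, as $n\to\infty$, $$\frac{a_{n,d}}{n!}= e^{-2}\left(1+\frac{4(d-1)}{n}+O\!\left(\frac{1}{n^2}\right)\right).$$ In particular $a_{n,d}/n!\to e^{-2}$.
   Context: For $n\ge 3$, $a_{n,0}$ denotes the number of permutations $\pi$ of $\{1,\dots,n\}$ such that $\pi(i+1)-\pi(i)\not\equiv \pm1 \pmod n$ for all $i\in\{1,\dots,n\}$, positions taken cyclically ($\pi(n+1):=\pi(1)$). For $d\ge1$ and $n\ge1$, $a_{n,d}$ denotes the number of permutations $\pi$ of $\{1,\dots,n\}$ such that $|\pi(i+d)-\pi(i)|\neq d$ for all $1\le i\le n-d$. *)

theory Defs
  imports "HOL-Combinatorics.Permutations" "HOL-Number_Theory.Cong" "HOL-Library.Landau_Symbols" Complex_Main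
begin

definition cyc_next :: "nat \<Rightarrow> nat \<Rightarrow> nat" where
  "cyc_next n i = (if i = n then 1 else i + 1)"

text \<open>a_{n,0}: permutations of {1..n} with pi(i+1) - pi(i) not congruent to +1 or -1 mod n,
  for all i in {1..n}, positions taken cyclically. (Meaningful for n >= 3.)\<close>
definition a0 :: "nat \<Rightarrow> nat" where
  "a0 n = card {p. p permutes {1..n} \<and>
     (\<forall>i\<in>{1..n}. \<not> [int (p (cyc_next n i)) - int (p i) = 1] (mod int n) \<and>
                  \<not> [int (p (cyc_next n i)) - int (p i) = -1] (mod int n))}"

definition ad :: "nat \<Rightarrow> nat \<Rightarrow> nat" where
  "ad d n = card {p. p permutes {1..n} \<and>
     (\<forall>i. 1 \<le> i \<and> i + d \<le> n \<longrightarrow> \<bar>int (p (i + d)) - int (p i)\<bar> \<noteq> int d)}"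

definition a :: "nat \<Rightarrow> nat \<Rightarrow> nat" where
  "a n d = (if d = 0 then a0 n else ad d n)"

end

theory Submission
  imports Defs "HOL-Analysis.Infinite_Products"
begin

text \<open>
  Positions and values carry the same structure: a vertex set of size n with a partial injective
  successor map that has no proper cycle. Call an edge of this graph bad for a permutation if the
  permutation maps it onto an edge; the permutations to be counted are those without bad edges.
  By the Bonferroni inequalities their number is an alternating sum, over sets of k edges, of the
  number of permutations for which all these edges are bad. The edge sets are sorted by the number of
  adjacent pairs of edges. With no pair, or with one, the number of permutations is known exactly; two or
  more pairs contribute only a relative error of order (k + 1)^4 / n^2. Expanding
  to first order in 1/n, the k-th term of the sum is
  (-2)^k / k! (1 + (k - 2 d k - k (k - 1) / 2) / n), uniformly for k up to a constant times the
  square root of n, and summing over k gives the claim.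
\<close>

text \<open>A permutation for which all edges of \<open>S\<close> are bad carries them onto an edge
  set with equally many adjacent pairs, so the classes without a pair and with one pair enter
  through the squares of their sizes. The class with one pair is not negligible: its weight is about
  \<open>v = k (k - 1) / n\<close>, which is of first order. Its absence from the class without
  pairs costs \<open>2 v\<close> after squaring, and its own term gives back \<open>v / 2\<close>.
  The number \<open>d\<close> matters only through two counts: there are \<open>n - d\<close> edges
  and \<open>n - 2 d\<close> paths of two edges. For \<open>d = 0\<close> the graph is one cycle,
  for larger \<open>d\<close> it is a union of paths with step \<open>d\<close>, and both counts
  have the same form. The expansion is not uniform in all \<open>k\<close>, so the alternating sum
  has to be cut at some \<open>K\<close> of order \<open>sqrt n\<close>. The terms decay like
  \<open>2 ^ k / k!\<close>; keeping four spare powers of \<open>k + 1\<close> in a convergent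
  majorant bounds both truncation errors by a multiple of \<open>K ^ (-4)\<close>, hence of
  \<open>n ^ (-2)\<close>.\<close>

section \<open>Permutations with prescribed values and prescribed images of a matching\<close>

lemma ex_permutes_extending:
  assumes "finite A" "V \<subseteq> A" "inj_on g V" "g ` V \<subseteq> A"
  obtains q where "q permutes A" "\<And>v. v \<in> V \<Longrightarrow> q v = g v"
proof -
  have fin: "finite V" using assms finite_subset by blast
  have "card (A - V) = card (A - g ` V)"
    using assms fin by (simp add: card_Diff_subset card_image)
  then obtain h where h: "bij_betw h (A - V) (A - g ` V)"
    using assms(1) finite_same_card_bij[of "A - V" "A - g ` V"] by auto
  define q where "q x = (if x \<in> V then g x else if x \<in> A then h x else x)" for x
  have "q ` V = g ` V" by (rule image_cong) (simp_all add: q_def)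
  moreover have "q ` (A - V) = h ` (A - V)" by (rule image_cong) (simp_all add: q_def)
  moreover have "h ` (A - V) = A - g ` V" using h by (simp add: bij_betw_def)
  ultimately have "q ` V \<union> q ` (A - V) = A" using assms(4) by (simp add: Un_absorb1)
  then have "q ` A = A" using assms(2) by (simp add: image_Un[symmetric] Un_absorb1)
  then have "bij_betw q A A"
    using assms(1) by (simp add: bij_betw_def eq_card_imp_inj_on)
  then have "q permutes A"
    by (rule bij_imp_permutes) (use assms(2) in \<open>auto simp: q_def\<close>)
  moreover have "q v = g v" if "v \<in> V" for v using that by (simp add: q_def)
  ultimately show thesis using that by blast
qed

text \<open>Composition with the inverse of one permutation extending \<open>g\<close> turns the
  condition into fixing \<open>V\<close> pointwise, which leaves the permutations of
  \<open>A - V\<close>.\<close>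

lemma card_permutes_pinned:
  assumes "finite A" "V \<subseteq> A" "inj_on g V" "g ` V \<subseteq> A"
  shows "card {p. p permutes A \<and> (\<forall>v\<in>V. p v = g v)} = fact (card A - card V)"
proof -
  obtain q where q: "q permutes A" "\<And>v. v \<in> V \<Longrightarrow> q v = g v"
    using ex_permutes_extending[OF assms] by metis
  have "{p. p permutes A \<and> (\<forall>v\<in>V. p v = g v)} = (\<lambda>r. q \<circ> r) ` {r. r permutes A - V}"
  proof (intro equalityI subsetI)
    fix p assume "p \<in> {p. p permutes A \<and> (\<forall>v\<in>V. p v = g v)}"
    then have p: "p permutes A" "\<And>v. v \<in> V \<Longrightarrow> p v = q v" using q by auto
    have r: "inv q \<circ> p permutes A"
      using p q by (simp add: permutes_compose permutes_inv)
    have "inv q \<circ> p permutes A - V"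
    proof (rule permutes_superset[OF r])
      fix x assume "x \<in> A - (A - V)"
      then show "(inv q \<circ> p) x = x"
        using p(2) permutes_inverses(2)[OF q(1)] by simp
    qed
    moreover have "p = q \<circ> (inv q \<circ> p)"
      using permutes_inverses(1)[OF q(1)] by (simp add: fun_eq_iff)
    ultimately show "p \<in> (\<lambda>r. q \<circ> r) ` {r. r permutes A - V}" by blast
  next
    fix p assume "p \<in> (\<lambda>r. q \<circ> r) ` {r. r permutes A - V}"
    then obtain r where r: "r permutes A - V" "p = q \<circ> r" by blast
    have "r permutes A" using r(1) permutes_subset by blast
    moreover have "r v = v" if "v \<in> V" for v
      using permutes_not_in[OF r(1)] that by blast
    ultimately show "p \<in> {p. p permutes A \<and> (\<forall>v\<in>V. p v = g v)}"
      using r q by (simp add: permutes_compose)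
  qed
  moreover have "inj_on (\<lambda>r. q \<circ> r) {r. r permutes A - V}"
    using permutes_inj[OF q(1)] by (auto intro!: inj_onI simp: fun_eq_iff inj_eq)
  moreover have "card (A - V) = card A - card V"
    using assms finite_subset by (metis card_Diff_subset)
  ultimately show ?thesis
    using assms(1) by (simp add: card_image card_permutations)
qed

definition matching :: "'a set set \<Rightarrow> bool" where
  "matching M \<longleftrightarrow> pairwise disjnt M \<and> (\<forall>e\<in>M. card e = 2)"

lemma matching_card: "matching M \<Longrightarrow> e \<in> M \<Longrightarrow> card e = 2"
  by (simp add: matching_def)

lemma matching_disjoint: "matching M \<Longrightarrow> e \<in> M \<Longrightarrow> f \<in> M \<Longrightarrow> e \<noteq> f \<Longrightarrow> e \<inter> f = {}"
  by (simp add: matching_def pairwise_def disjnt_def)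

lemma card_orientations:
  assumes "finite M" "matching M"
  shows "card {(c, c'). {c, c'} \<in> M} = 2 * card M"
proof -
  have eq: "{(c, c'). {c, c'} \<in> M} = (\<Union>e\<in>M. {(c, c'). {c, c'} = e})" by auto
  have two: "finite {(c, c'). {c, c'} = e} \<and> card {(c, c'). {c, c'} = e} = 2" if "e \<in> M" for e
  proof -
    obtain x y where xy: "e = {x, y}" "x \<noteq> y"
      using matching_card[OF assms(2) \<open>e \<in> M\<close>] by (auto simp: card_2_iff)
    then have "{(c, c'). {c, c'} = e} = {(x, y), (y, x)}" by (auto simp: doubleton_eq_iff)
    then show ?thesis using xy by simp
  qed
  have "card {(c, c'). {c, c'} \<in> M} = (\<Sum>e\<in>M. card {(c, c'). {c, c'} = e})"
    unfolding eq using assms(1) two by (intro card_UN_disjoint) auto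
  then show ?thesis using two by simp
qed

text \<open>One edge of \<open>S\<close> has \<open>2 * k\<close> possible oriented images in
  \<open>T\<close>. Once it is placed, its endpoints count as pinned and both matchings have lost an
  edge; this is why the induction carries a general pinned part \<open>V\<close>,
  \<open>g\<close>.\<close>

lemma card_permutes_matching:
  assumes "finite A" "V \<subseteq> A" "inj_on g V" "g ` V \<subseteq> A"
    and "matching S" "\<Union>S \<subseteq> A - V" "matching T" "\<Union>T \<subseteq> A - g ` V"
    and "finite S" "card S = k" "card T = k"
  shows "card {p. p permutes A \<and> (\<forall>v\<in>V. p v = g v) \<and> (\<forall>e\<in>S. p ` e \<in> T)}
           = fact k * 2 ^ k * fact (card A - card V - 2 * k)"
  using assms
proof (induction k arbitrary: S T V g)
  case 0
  then have "S = {}" by simp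
  with 0 show ?case by (simp add: card_permutes_pinned)
next
  case (Suc k)
  have finT: "finite T" using Suc.prems(11) card.infinite by fastforce
  obtain e where e: "e \<in> S" using Suc.prems(10) by fastforce
  obtain x y where xy: "e = {x, y}" "x \<noteq> y"
    using matching_card[OF Suc.prems(5) e] by (auto simp: card_2_iff)
  have xyA: "x \<in> A" "y \<in> A" "x \<notin> V" "y \<notin> V" using e xy Suc.prems(6) by auto
  define P where "P = (\<lambda>(c, c'). {p. p permutes A \<and> (\<forall>v\<in>V. p v = g v) \<and> p x = c \<and> p y = c'
                                    \<and> (\<forall>f\<in>S. p ` f \<in> T)})"
  have "card (P (c, c')) = fact k * 2 ^ k * fact (card A - card V - 2 * Suc k)"
    if "{c, c'} \<in> T" for c c'
  proof -
    define V' where "V' = insert x (insert y V)"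
    define g' where "g' = g(x := c, y := c')"
    have cc: "c \<noteq> c'" "c \<in> A" "c' \<in> A" "c \<notin> g ` V" "c' \<notin> g ` V"
      using that Suc.prems(7,8) by (auto simp: matching_def)
    have g'V: "g' v = g v" if "v \<in> V" for v
      using that xyA by (auto simp: g'_def)
    have g'im: "g' ` V' = insert c (insert c' (g ` V))"
    proof -
      have "g' ` V = g ` V" by (rule image_cong) (use g'V in auto)
      moreover have "g' x = c" "g' y = c'" using xy by (auto simp: g'_def)
      ultimately show ?thesis by (simp add: V'_def)
    qed
    have dS: "\<And>f. f \<in> S \<Longrightarrow> f \<noteq> e \<Longrightarrow> f \<inter> e = {}" and dT: "\<And>f. f \<in> T \<Longrightarrow> f \<noteq> {c, c'} \<Longrightarrow> f \<inter> {c, c'} = {}"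
      using matching_disjoint[OF Suc.prems(5)] matching_disjoint[OF Suc.prems(7)] e that by auto
    have Pe: "P (c, c') = {p. p permutes A \<and> (\<forall>v\<in>V'. p v = g' v) \<and> (\<forall>f\<in>S - {e}. p ` f \<in> T - {{c, c'}})}"
    proof (intro equalityI subsetI)
      fix p assume "p \<in> P (c, c')"
      then have p: "p permutes A" "\<forall>v\<in>V. p v = g v" "p x = c" "p y = c'" "\<forall>f\<in>S. p ` f \<in> T"
        by (auto simp: P_def)
      \<comment> \<open>Injectivity keeps the other edges of \<open>S\<close> away from the image of
        \<open>e\<close>, so that they form an instance with \<open>k\<close> edges on each
        side.\<close>
      have "p ` f \<noteq> {c, c'}" if "f \<in> S" "f \<noteq> e" for f
      proof
        assume "p ` f = {c, c'}"
        then have "p ` f = p ` e" using p xy by simp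
        then have "f = e" using permutes_inj[OF p(1)] by (simp add: inj_image_eq_iff)
        with that show False by simp
      qed
      then have "\<forall>f\<in>S - {e}. p ` f \<in> T - {{c, c'}}" using p(5) by blast
      moreover have "p v = g' v" if "v \<in> V'" for v
        using that p(2-4) g'V unfolding V'_def by (auto simp: g'_def)
      ultimately show "p \<in> {p. p permutes A \<and> (\<forall>v\<in>V'. p v = g' v) \<and> (\<forall>f\<in>S - {e}. p ` f \<in> T - {{c, c'}})}"
        using p(1) by blast
    next
      fix p assume "p \<in> {p. p permutes A \<and> (\<forall>v\<in>V'. p v = g' v) \<and> (\<forall>f\<in>S - {e}. p ` f \<in> T - {{c, c'}})}"
      then have p: "p permutes A" "\<forall>v\<in>V'. p v = g' v" "\<forall>f\<in>S - {e}. p ` f \<in> T - {{c, c'}}" by auto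
      have "p x = c" "p y = c'" using p(2) xy by (auto simp: V'_def g'_def)
      moreover have "\<forall>v\<in>V. p v = g v" using p(2) g'V by (auto simp: V'_def)
      moreover have "p ` e \<in> T" using calculation xy that by simp
      moreover have "\<forall>f\<in>S. p ` f \<in> T"
        using \<open>p ` e \<in> T\<close> p(3) by blast
      ultimately show "p \<in> P (c, c')" using p(1) by (simp add: P_def)
    qed
    have injg': "inj_on g' V'"
    proof -
      have "inj_on g' V" using Suc.prems(3) g'V by (simp add: inj_on_def)
      moreover have "g' x = c" "g' y = c'" using xy by (auto simp: g'_def)
      moreover have "g' ` V = g ` V" by (rule image_cong) (use g'V in auto)
      moreover have "insert y V - {x} = insert y V" "V - {y} = V" using xy xyA by auto
      ultimately show ?thesis using cc unfolding V'_def by simp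
    qed
    have "card (P (c, c')) = fact k * 2 ^ k * fact (card A - card V' - 2 * k)"
      unfolding Pe
    proof (rule Suc.IH[OF Suc.prems(1) _ injg'])
      show "V' \<subseteq> A" using Suc.prems(2) xyA by (simp add: V'_def)
      show "g' ` V' \<subseteq> A" using Suc.prems(4) cc by (simp add: g'im)
      show "matching (S - {e})" "matching (T - {{c, c'}})"
        using Suc.prems(5,7) by (auto simp: matching_def pairwise_def)
      show "\<Union>(S - {e}) \<subseteq> A - V'"
      proof
        fix z assume "z \<in> \<Union>(S - {e})"
        then obtain f where f: "z \<in> f" "f \<in> S" "f \<noteq> e" by blast
        then have "z \<noteq> x" "z \<noteq> y" using dS[OF f(2,3)] xy(1) by blast+
        then show "z \<in> A - V'" using f Suc.prems(6) unfolding V'_def by blast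
      qed
      show "\<Union>(T - {{c, c'}}) \<subseteq> A - g' ` V'"
      proof
        fix z assume "z \<in> \<Union>(T - {{c, c'}})"
        then obtain f where f: "z \<in> f" "f \<in> T" "f \<noteq> {c, c'}" by blast
        then have "z \<noteq> c" "z \<noteq> c'" using dT[OF f(2,3)] by blast+
        then show "z \<in> A - g' ` V'" using f Suc.prems(8) unfolding g'im by blast
      qed
      show "finite (S - {e})" "card (S - {e}) = k" "card (T - {{c, c'}}) = k"
        using Suc.prems e that finT by auto
    qed
    moreover have "card V' = card V + 2"
      using xyA xy finite_subset[OF Suc.prems(2,1)] by (simp add: V'_def)
    ultimately show ?thesis by (simp add: diff_diff_left)
  qed
  note cardP = this
  have finP: "finite {p. p permutes A}" using Suc.prems(1) finite_permutations by blast
  have "{p. p permutes A \<and> (\<forall>v\<in>V. p v = g v) \<and> (\<forall>f\<in>S. p ` f \<in> T)}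
          = (\<Union>cc\<in>{(c, c'). {c, c'} \<in> T}. P cc)"
  proof (intro equalityI subsetI)
    fix p assume p: "p \<in> {p. p permutes A \<and> (\<forall>v\<in>V. p v = g v) \<and> (\<forall>f\<in>S. p ` f \<in> T)}"
    then have "p ` e \<in> T" using e by simp
    then have "(p x, p y) \<in> {(c, c'). {c, c'} \<in> T}" using xy by simp
    moreover have "p \<in> P (p x, p y)" using p by (simp add: P_def)
    ultimately show "p \<in> (\<Union>cc\<in>{(c, c'). {c, c'} \<in> T}. P cc)" by (rule UN_I)
  qed (auto simp: P_def)
  moreover have "finite {(c, c'). {c, c'} \<in> T}"
    using card_orientations[OF finT Suc.prems(7)] Suc.prems(11) by (intro card_ge_0_finite) simp
  moreover have "finite (P cc)" for cc
    by (rule finite_subset[OF _ finP]) (auto simp: P_def split: prod.splits)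
  moreover have "P cc \<inter> P dd = {}" if "cc \<noteq> dd" for cc dd
    using that unfolding P_def by (cases cc; cases dd) auto
  ultimately have "card {p. p permutes A \<and> (\<forall>v\<in>V. p v = g v) \<and> (\<forall>f\<in>S. p ` f \<in> T)}
      = (\<Sum>cc\<in>{(c, c'). {c, c'} \<in> T}. card (P cc))"
    by (simp add: card_UN_disjoint)
  also have "\<dots> = (\<Sum>cc\<in>{(c, c'). {c, c'} \<in> T}. fact k * 2 ^ k * fact (card A - card V - 2 * Suc k))"
    by (rule sum.cong) (use cardP in auto)
  also have "\<dots> = 2 * Suc k * (fact k * 2 ^ k * fact (card A - card V - 2 * Suc k))"
    using card_orientations[OF finT Suc.prems(7)] Suc.prems(11) by simp
  finally show ?case by (simp add: algebra_simps)
qed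

section \<open>Successor graphs and permutations with prescribed bad edges\<close>

text \<open>\<open>D\<close> is the set of starting points of edges, and an edge is named by its
  starting point. The exception \<open>S \<noteq> A\<close> admits the single cycle through all
  vertices; the bound on \<open>card A\<close> keeps sets of one or two vertices from being that
  exception, which rules out loops and two-cycles.\<close>

locale successor =
  fixes A D :: "'a set" and s :: "'a \<Rightarrow> 'a"
  assumes finite_A: "finite A" and D_subset: "D \<subseteq> A" and s_in: "x \<in> D \<Longrightarrow> s x \<in> A"
    and s_inj: "inj_on s D"
    and no_proper_cycle: "S \<subseteq> D \<Longrightarrow> S \<noteq> {} \<Longrightarrow> S \<noteq> A \<Longrightarrow> \<exists>x\<in>S. s x \<notin> S"
    and card_A: "4 \<le> card A"
begin

text \<open>Unordered, so that both signs of the forbidden difference are covered at once.\<close>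

definition E :: "'a \<Rightarrow> 'a set" where "E x = {x, s x}"

definition bad :: "('a \<Rightarrow> 'a) \<Rightarrow> 'a set" where "bad p = {e \<in> D. p ` E e \<in> E ` D}"

text \<open>The size of \<open>adj S\<close> is the number of adjacent pairs among the edges starting in \<open>S\<close>.\<close>

definition adj :: "'a set \<Rightarrow> 'a set" where "adj S = {x \<in> S. s x \<in> S}"

definition F :: "nat \<Rightarrow> nat \<Rightarrow> 'a set set" where
  "F k w = {S. S \<subseteq> D \<and> card S = k \<and> card (adj S) = w}"

definition N :: "'a set \<Rightarrow> ('a \<Rightarrow> 'a) set" where "N S = {p. p permutes A \<and> S \<subseteq> bad p}"

lemma finite_D: "finite D"
  using finite_A D_subset finite_subset by blast

lemma finite_sub: "S \<subseteq> D \<Longrightarrow> finite S"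
  using finite_D finite_subset by blast

lemma finite_F: "finite (F k w)"
  by (rule finite_subset[of _ "Pow D"]) (auto simp: F_def finite_D)

lemma finite_perms: "finite {p. p permutes A}"
  using finite_A finite_permutations by blast

lemma s_eq_iff: "x \<in> D \<Longrightarrow> y \<in> D \<Longrightarrow> s x = s y \<longleftrightarrow> x = y"
  using s_inj by (simp add: inj_on_eq_iff)

lemma s_neq: assumes "x \<in> D" shows "s x \<noteq> x"
proof -
  have "{x} \<noteq> A" using card_A by auto
  then show ?thesis using no_proper_cycle[of "{x}"] assms by simp
qed

lemma s_s_neq: assumes "x \<in> D" "s x \<in> D" shows "s (s x) \<noteq> x"
proof -
  have "card {x, s x} \<le> 2" by (simp add: card_insert_if)
  then have "{x, s x} \<noteq> A" using card_A by auto
  then show ?thesis using no_proper_cycle[of "{x, s x}"] assms s_neq by auto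
qed

lemma card_E: "x \<in> D \<Longrightarrow> card (E x) = 2"
  using s_neq[of x] by (auto simp: E_def card_2_iff)

lemma inj_E: "inj_on E D"
proof (rule inj_onI)
  fix x y assume xy: "x \<in> D" "y \<in> D" "E x = E y"
  show "x = y"
  proof (rule ccontr)
    assume "x \<noteq> y"
    then have "y = s x" "x = s y" using xy(3) by (auto simp: E_def doubleton_eq_iff)
    then show False using s_s_neq[of x] xy by simp
  qed
qed

lemma E_inter:
  assumes "x \<in> D" "y \<in> D" "x \<noteq> y" "E x \<inter> E y \<noteq> {}"
  shows "y = s x \<or> x = s y"
  using assms s_eq_iff[of x y] by (auto simp: E_def)

lemma Union_E: "\<Union>(E ` S) = S \<union> s ` S"
  by (auto simp: E_def)

lemma Union_E_subset: "S \<subseteq> D \<Longrightarrow> \<Union>(E ` S) \<subseteq> A"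
  unfolding Union_E using D_subset s_in by blast

text \<open>Every edge has two endpoints. A vertex is counted twice exactly if it ends one edge of
  \<open>S\<close> and starts another, that is, if it is \<open>s x\<close> for some
  \<open>x\<close> in \<open>adj S\<close>.\<close>

lemma card_Union_E:
  assumes "S \<subseteq> D"
  shows "card (\<Union>(E ` S)) + card (adj S) = 2 * card S"
proof -
  have inj: "inj_on s S" using s_inj assms inj_on_subset by blast
  have "S \<inter> s ` S = s ` adj S" by (auto simp: adj_def)
  moreover have "inj_on s (adj S)" using inj by (rule inj_on_subset) (auto simp: adj_def)
  ultimately have "card (S \<inter> s ` S) = card (adj S)" by (simp add: card_image)
  moreover have "card S + card (s ` S) = card (S \<union> s ` S) + card (S \<inter> s ` S)"
    using assms finite_sub by (intro card_Un_Int) auto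
  ultimately show ?thesis using inj by (simp add: Union_E card_image)
qed

lemma card_adj_le: "S \<subseteq> D \<Longrightarrow> card (adj S) \<le> card S"
  using finite_sub by (intro card_mono) (auto simp: adj_def)

lemma image_E_eq_iff:
  assumes "p permutes A" "S \<subseteq> D" "T \<subseteq> D" "card S = card T"
  shows "(`) p ` E ` S = E ` T \<longleftrightarrow> (\<forall>e\<in>E ` S. p ` e \<in> E ` T)"
proof
  assume *: "\<forall>e\<in>E ` S. p ` e \<in> E ` T"
  have "inj_on ((`) p) (E ` S)"
    using permutes_inj[OF assms(1)] by (auto simp: inj_on_def inj_image_eq_iff)
  moreover have "inj_on E S" "inj_on E T" using inj_E assms inj_on_subset by blast+
  ultimately have "card ((`) p ` E ` S) = card (E ` T)" using assms(4) by (simp add: card_image)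
  moreover have "(`) p ` E ` S \<subseteq> E ` T" using * by blast
  moreover have "finite (E ` T)" using finite_sub[OF assms(3)] by simp
  ultimately show "(`) p ` E ` S = E ` T" by (simp add: card_subset_eq)
qed blast

text \<open>The edges in \<open>S\<close> and the edges onto which they are mapped touch equally many vertices, so by
  \<open>card_Union_E\<close> they have equally many adjacent pairs.\<close>

lemma card_N_eq_sum:
  assumes "S \<in> F k w"
  shows "card (N S) = (\<Sum>T\<in>F k w. card {p. p permutes A \<and> (\<forall>e\<in>E ` S. p ` e \<in> E ` T)})"
proof -
  have S: "S \<subseteq> D" "card S = k" "card (adj S) = w" using assms by (auto simp: F_def)
  define P where "P T = {p. p permutes A \<and> (`) p ` E ` S = E ` T}" for T
  have P_eq: "P T = {p. p permutes A \<and> (\<forall>e\<in>E ` S. p ` e \<in> E ` T)}" if "T \<in> F k w" for T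
  proof -
    have "T \<subseteq> D" "card S = card T" using S that by (auto simp: F_def)
    then show ?thesis
      unfolding P_def by (intro Collect_cong conj_cong refl image_E_eq_iff S(1))
  qed
  have "N S = (\<Union>T\<in>F k w. P T)"
  proof (intro equalityI subsetI)
    fix p assume "p \<in> N S"
    then have p: "p permutes A" "S \<subseteq> bad p" by (auto simp: N_def)
    define T where "T = {f \<in> D. E f \<in> (`) p ` E ` S}"
    have TD: "T \<subseteq> D" by (auto simp: T_def)
    have "p ` E e \<in> E ` D" if "e \<in> S" for e using p(2) that by (auto simp: bad_def)
    then have "(`) p ` E ` S \<subseteq> E ` D" by blast
    then have im: "(`) p ` E ` S = E ` T"
    proof (intro equalityI subsetI)
      fix y assume y: "y \<in> (`) p ` E ` S" and "(`) p ` E ` S \<subseteq> E ` D"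
      then obtain f where "f \<in> D" "y = E f" by blast
      then show "y \<in> E ` T" using y by (simp add: T_def)
    next
      fix y assume "y \<in> E ` T"
      then show "y \<in> (`) p ` E ` S" by (auto simp only: T_def)
    qed
    have "inj_on ((`) p) (E ` S)"
      using permutes_inj[OF p(1)] by (auto simp: inj_on_def inj_image_eq_iff)
    moreover have "inj_on E S" "inj_on E T" using inj_E S TD inj_on_subset by blast+
    ultimately have cT: "card T = k" using im S(2) by (metis card_image)
    have "\<Union>(E ` T) = p ` \<Union>(E ` S)" unfolding im[symmetric] by blast
    then have "card (\<Union>(E ` T)) = card (\<Union>(E ` S))"
      using permutes_inj_on[OF p(1)] by (simp add: card_image)
    then have "card (adj T) = w"
      using card_Union_E[OF TD] card_Union_E[OF S(1)] S cT by linarith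
    then have "T \<in> F k w" using TD cT by (simp add: F_def)
    then show "p \<in> (\<Union>T\<in>F k w. P T)" using p(1) im by (auto simp: P_def)
  next
    fix p assume "p \<in> (\<Union>T\<in>F k w. P T)"
    then obtain T where T: "T \<in> F k w" "p permutes A" "(`) p ` E ` S = E ` T" by (auto simp: P_def)
    have "p ` E e \<in> E ` D" if "e \<in> S" for e
    proof -
      have "p ` E e \<in> E ` T" unfolding T(3)[symmetric] using that by blast
      then show ?thesis using T(1) by (auto simp: F_def)
    qed
    then show "p \<in> N S" using T(2) S(1) by (auto simp: N_def bad_def)
  qed
  moreover have "P T \<inter> P T' = {}" if "T \<in> F k w" "T' \<in> F k w" "T \<noteq> T'" for T T'
  proof -
    have "T \<subseteq> D" "T' \<subseteq> D" using that by (auto simp: F_def)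
    then have "E ` T \<noteq> E ` T'" using that(3) inj_on_image_eq_iff[OF inj_E, of T T'] by simp
    then show ?thesis by (simp add: P_def disjoint_iff)
  qed
  moreover have "finite (P T)" for T
    by (rule finite_subset[OF _ finite_perms]) (auto simp: P_def)
  ultimately have "card (N S) = (\<Sum>T\<in>F k w. card (P T))"
    using finite_F by (simp add: card_UN_disjoint)
  then show ?thesis using P_eq by simp
qed

lemma matching_E:
  assumes "S \<subseteq> D" "\<And>x y. x \<in> S \<Longrightarrow> y \<in> S \<Longrightarrow> y \<noteq> s x"
  shows "matching (E ` S)"
proof -
  have "E x \<inter> E y = {}" if "x \<in> S" "y \<in> S" "x \<noteq> y" for x y
    using E_inter[of x y] assms that by blast
  then show ?thesis
    using assms(1) card_E by (auto simp: matching_def pairwise_def disjnt_def subset_iff)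
qed

text \<open>Without adjacent pairs the edges on both sides form matchings with \<open>k\<close>
  edges, and no vertex is pinned. Every target \<open>T\<close> therefore allows the same number of
  permutations.\<close>

lemma card_N_0:
  assumes "S \<in> F k 0"
  shows "card (N S) = card (F k 0) * (fact k * 2 ^ k * fact (card A - 2 * k))"
proof -
  have match: "matching (E ` T) \<and> T \<subseteq> D \<and> card (E ` T) = k" if "T \<in> F k 0" for T
  proof -
    have T: "T \<subseteq> D" "card T = k" "adj T = {}"
      using that finite_sub[of T] by (auto simp: F_def adj_def)
    have "matching (E ` T)" using T(3) by (intro matching_E[OF T(1)]) (auto simp: adj_def)
    moreover have "inj_on E T" using inj_E T inj_on_subset by blast
    ultimately show ?thesis using T by (simp add: card_image)
  qed
  have "card {p. p permutes A \<and> (\<forall>e\<in>E ` S. p ` e \<in> E ` T)} = fact k * 2 ^ k * fact (card A - 2 * k)"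
    if "T \<in> F k 0" for T
    using card_permutes_matching[of A "{}" id "E ` S" "E ` T" k] match[OF assms] match[OF that]
      Union_E_subset finite_A finite_sub by simp
  then show ?thesis by (simp add: card_N_eq_sum[OF assms])
qed

text \<open>One adjacent pair means one path on the three vertices \<open>x\<close>,
  \<open>s x\<close>, \<open>s (s x)\<close> and a matching formed by all other edges, disjoint from
  the path: any further contact would be a second pair.\<close>

lemma adj_single:
  assumes "S \<subseteq> D" "adj S = {x}"
  shows "x \<in> D" "s x \<in> D" "x \<noteq> s x" "x \<in> S" "s x \<in> S" "s (s x) \<in> A"
    "distinct [x, s x, s (s x)]"
    "matching (E ` (S - {x, s x}))" "\<Union>(E ` (S - {x, s x})) \<subseteq> A - {x, s x, s (s x)}"
proof -
  show x: "x \<in> S" "s x \<in> S" using assms by (auto simp: adj_def)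
  then show xD: "x \<in> D" "s x \<in> D" using assms by auto
  then show "s (s x) \<in> A" using s_in by blast
  show "x \<noteq> s x" using s_neq[OF xD(1)] by simp
  show "distinct [x, s x, s (s x)]" using s_neq[OF xD(1)] s_neq[OF xD(2)] s_s_neq[OF xD] by auto
  have only: "y \<in> S \<Longrightarrow> s y \<in> S \<Longrightarrow> y = x" for y using assms(2) by (auto simp: adj_def)
  show "matching (E ` (S - {x, s x}))"
  proof (rule matching_E)
    show "S - {x, s x} \<subseteq> D" using assms by blast
    fix y z assume "y \<in> S - {x, s x}" "z \<in> S - {x, s x}"
    then show "z \<noteq> s y" using only[of y] by auto
  qed
  have "E z \<subseteq> A - {x, s x, s (s x)}" if z: "z \<in> S" "z \<noteq> x" "z \<noteq> s x" for z
  proof -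
    have zD: "z \<in> D" using z assms(1) by blast
    have "z \<noteq> s (s x)" using only[of "s x"] x z s_neq[OF xD(1)] by auto
    moreover have "s z \<noteq> x" using only[of z] x z by auto
    moreover have "s z \<noteq> s x" "s z \<noteq> s (s x)"
      using s_eq_iff[OF zD xD(1)] s_eq_iff[OF zD xD(2)] z by auto
    ultimately show ?thesis using z zD s_in D_subset by (auto simp: E_def)
  qed
  then show "\<Union>(E ` (S - {x, s x})) \<subseteq> A - {x, s x, s (s x)}" by blast
qed

text \<open>With the three path vertices pinned by \<open>g\<close>, the remaining
  \<open>k - 2\<close> edges on each side are matchings off the path.\<close>

lemma card_extend_path:
  assumes S: "S \<subseteq> D" "adj S = {x}" and T: "T \<subseteq> D" "adj T = {y}" and k: "card S = k" "card T = k"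
    and g: "g ` {x, s x, s (s x)} = {y, s y, s (s y)}"
  shows "card {p. p permutes A \<and> (\<forall>v\<in>{x, s x, s (s x)}. p v = g v) \<and>
            (\<forall>e\<in>E ` (S - {x, s x}). p ` e \<in> E ` (T - {y, s y}))}
         = fact (k - 2) * 2 ^ (k - 2) * fact (card A - 3 - 2 * (k - 2))"
proof -
  have c3: "card {x, s x, s (s x)} = 3" "card {y, s y, s (s y)} = 3"
    using adj_single(7)[OF S] adj_single(7)[OF T] by auto
  have "inj_on g {x, s x, s (s x)}"
    by (rule eq_card_imp_inj_on) (use c3 g in simp_all)
  moreover have "card (E ` (S - {x, s x})) = k - 2" "card (E ` (T - {y, s y})) = k - 2"
  proof -
    have "inj_on E (S - {x, s x})" "inj_on E (T - {y, s y})"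
      using S(1) T(1) by (auto intro!: inj_on_subset[OF inj_E])
    then show "card (E ` (S - {x, s x})) = k - 2" "card (E ` (T - {y, s y})) = k - 2"
      using adj_single(3-5)[OF S] adj_single(3-5)[OF T] k by (simp_all add: card_image card_Diff_subset)
  qed
  moreover have "{x, s x, s (s x)} \<subseteq> A" "g ` {x, s x, s (s x)} \<subseteq> A"
    unfolding g using adj_single[OF S] adj_single[OF T] D_subset by blast+
  moreover have "finite (E ` (S - {x, s x}))" using finite_sub[OF S(1)] by simp
  moreover have "\<Union>(E ` (T - {y, s y})) \<subseteq> A - g ` {x, s x, s (s x)}"
    unfolding g by (rule adj_single(9)[OF T])
  ultimately have "card {p. p permutes A \<and> (\<forall>v\<in>{x, s x, s (s x)}. p v = g v) \<and>
            (\<forall>e\<in>E ` (S - {x, s x}). p ` e \<in> E ` (T - {y, s y}))}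
         = fact (k - 2) * 2 ^ (k - 2) * fact (card A - card {x, s x, s (s x)} - 2 * (k - 2))"
    by (intro card_permutes_matching finite_A adj_single(8,9)[OF S] adj_single(8)[OF T])
  then show ?thesis unfolding c3 .
qed

text \<open>The two edges meeting at \<open>s x\<close> go to two edges of \<open>T\<close> that
  meet, and the only such edges meet at \<open>s y\<close>. So the middle goes to the middle and
  only the direction of the path is free.\<close>

lemma extend_path_cases:
  assumes S: "S \<subseteq> D" "adj S = {x}" and T: "T \<subseteq> D" "adj T = {y}"
    and p: "p permutes A" "\<forall>e\<in>E ` S. p ` e \<in> E ` T"
  shows "p (s x) = s y \<and> (p x = y \<and> p (s (s x)) = s (s y) \<or> p x = s (s y) \<and> p (s (s x)) = y)"
    and "\<forall>e\<in>E ` (S - {x, s x}). p ` e \<in> E ` (T - {y, s y})"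
proof -
  note xS = adj_single[OF S] and yT = adj_single[OF T]
  have inj: "inj p" using permutes_inj[OF p(1)] .
  have "p ` E x \<in> E ` T" "p ` E (s x) \<in> E ` T" using p(2) xS(4,5) by simp_all
  then obtain f f' where f: "f \<in> T" "p ` E x = E f" "f' \<in> T" "p ` E (s x) = E f'"
    by (elim imageE)
  have D: "f \<in> D" "f' \<in> D" using f T by auto
  have "E x \<noteq> E (s x)" using inj_onD[OF inj_E _ xS(1,2)] xS(3) by blast
  then have "f \<noteq> f'" using f inj by (metis inj_image_eq_iff)
  have mem: "p (s x) \<in> E f" "p (s x) \<in> E f'"
    unfolding f(2)[symmetric] f(4)[symmetric] by (auto simp: E_def)
  have only: "z = y" if "z \<in> T" "s z \<in> T" for z using T(2) that by (auto simp: adj_def)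
  have "f' = s f \<or> f = s f'" using E_inter[OF D \<open>f \<noteq> f'\<close>] mem by blast
  then have ff': "f = y \<and> f' = s y \<or> f' = y \<and> f = s y"
    using only[of f] only[of f'] f(1,3) by metis
  then have set_eq: "{E f, E f'} = {E y, E (s y)}" by auto
  have sx: "p (s x) = s y"
    using ff'
  proof
    assume "f = y \<and> f' = s y"
    then have "p (s x) \<in> {y, s y}" "p (s x) \<in> {s y, s (s y)}" using mem by (simp_all add: E_def)
    then show ?thesis using yT(7) by auto
  next
    assume "f' = y \<and> f = s y"
    then have "p (s x) \<in> {y, s y}" "p (s x) \<in> {s y, s (s y)}" using mem by (simp_all add: E_def)
    then show ?thesis using yT(7) by auto
  qed
  have *: "p ` {x, s x} = E f" "p ` {s x, s (s x)} = E f'" using f(2,4) by (simp_all add: E_def)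
  have ne: "p x \<noteq> s y" "p (s (s x)) \<noteq> s y"
    using inj xS(7) unfolding sx[symmetric] by (auto simp: inj_eq)
  show "p (s x) = s y \<and> (p x = y \<and> p (s (s x)) = s (s y) \<or> p x = s (s y) \<and> p (s (s x)) = y)"
    using ff'
  proof
    assume "f = y \<and> f' = s y"
    then have "p x \<in> {y, s y}" "p (s (s x)) \<in> {s y, s (s y)}" using * by (simp_all add: E_def set_eq_iff) metis+
    then show ?thesis using sx ne by auto
  next
    assume "f' = y \<and> f = s y"
    then have "p x \<in> {s y, s (s y)}" "p (s (s x)) \<in> {y, s y}" using * by (simp_all add: E_def set_eq_iff) metis+
    then show ?thesis using sx ne by auto
  qed
  show "\<forall>e\<in>E ` (S - {x, s x}). p ` e \<in> E ` (T - {y, s y})"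
  proof
    fix e assume "e \<in> E ` (S - {x, s x})"
    then obtain z where z: "z \<in> S" "z \<noteq> x" "z \<noteq> s x" "e = E z" by blast
    have zD: "z \<in> D" using z S by blast
    have "E z \<noteq> E x" "E z \<noteq> E (s x)"
      using inj_onD[OF inj_E _ zD] xS(1,2) z by blast+
    then have "p ` e \<noteq> E f" "p ` e \<noteq> E f'"
      unfolding z(4) f(2)[symmetric] f(4)[symmetric] using inj by (simp_all add: inj_image_eq_iff)
    then have "p ` e \<notin> {E f, E f'}" by simp
    then have "p ` e \<notin> {E y, E (s y)}" unfolding set_eq .
    then have "p ` e \<noteq> E y" "p ` e \<noteq> E (s y)" by simp_all
    moreover have "p ` e \<in> E ` T" using p(2) z by blast
    ultimately show "p ` e \<in> E ` (T - {y, s y})" by blast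
  qed
qed

text \<open>For each target \<open>T\<close> the path is placed forwards (\<open>g1\<close>) or
  backwards (\<open>g2\<close>). These two options turn the factor \<open>2 ^ (k - 2)\<close> of the
  remaining matching into \<open>2 ^ (k - 1)\<close>.\<close>

lemma card_N_1:
  assumes "S \<in> F k 1" "2 \<le> k"
  shows "card (N S) = card (F k 1) * (fact (k - 2) * 2 ^ (k - 1) * fact (card A + 1 - 2 * k))"
proof -
  obtain x where S: "S \<subseteq> D" "adj S = {x}" "card S = k"
    using assms by (auto simp: F_def card_1_singleton_iff)
  note xS = adj_single[OF S(1,2)]
  have "card {p. p permutes A \<and> (\<forall>e\<in>E ` S. p ` e \<in> E ` T)}
          = fact (k - 2) * 2 ^ (k - 1) * fact (card A + 1 - 2 * k)" if "T \<in> F k 1" for T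
  proof -
    obtain y where T: "T \<subseteq> D" "adj T = {y}" "card T = k"
      using \<open>T \<in> F k 1\<close> by (auto simp: F_def card_1_singleton_iff)
    note yT = adj_single[OF T(1,2)]
    define P where "P g = {p. p permutes A \<and> (\<forall>v\<in>{x, s x, s (s x)}. p v = g v) \<and>
            (\<forall>e\<in>E ` (S - {x, s x}). p ` e \<in> E ` (T - {y, s y}))}" for g
    define g1 where "g1 = id(x := y, s x := s y, s (s x) := s (s y))"
    define g2 where "g2 = id(x := s (s y), s x := s y, s (s x) := y)"
    have g1: "g1 x = y" "g1 (s x) = s y" "g1 (s (s x)) = s (s y)"
      and g2: "g2 x = s (s y)" "g2 (s x) = s y" "g2 (s (s x)) = y"
      using xS(7) by (auto simp: g1_def g2_def)
    have eq: "{p. p permutes A \<and> (\<forall>e\<in>E ` S. p ` e \<in> E ` T)} = P g1 \<union> P g2"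
    proof (intro equalityI subsetI)
      fix p assume "p \<in> {p. p permutes A \<and> (\<forall>e\<in>E ` S. p ` e \<in> E ` T)}"
      then have p: "p permutes A" "\<forall>e\<in>E ` S. p ` e \<in> E ` T" by auto
      show "p \<in> P g1 \<union> P g2"
        using extend_path_cases[OF S(1,2) T(1,2) p] p(1) g1 g2 unfolding P_def by simp
    next
      fix p assume p: "p \<in> P g1 \<union> P g2"
      have "p ` E z \<in> E ` T" if "z \<in> S" for z
      proof (cases "z = x \<or> z = s x")
        case True
        have "p ` E x \<in> {E y, E (s y)} \<and> p ` E (s x) \<in> {E y, E (s y)}"
          using p by (auto simp: P_def E_def g1 g2)
        then show ?thesis using True yT(4,5) by auto
      next
        case False
        then have "E z \<in> E ` (S - {x, s x})" using \<open>z \<in> S\<close> by blast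
        then have "p ` E z \<in> E ` (T - {y, s y})" using p unfolding P_def by blast
        then show ?thesis by blast
      qed
      moreover have "p permutes A" using p by (auto simp: P_def)
      ultimately show "p \<in> {p. p permutes A \<and> (\<forall>e\<in>E ` S. p ` e \<in> E ` T)}" by blast
    qed
    have cP: "card (P g1) = fact (k - 2) * 2 ^ (k - 2) * fact (card A - 3 - 2 * (k - 2))"
         "card (P g2) = fact (k - 2) * 2 ^ (k - 2) * fact (card A - 3 - 2 * (k - 2))"
      unfolding P_def using S T by (intro card_extend_path; auto simp: g1 g2)+
    have "finite (P g)" for g
      by (rule finite_subset[OF _ finite_perms]) (auto simp: P_def)
    moreover have "P g1 \<inter> P g2 = {}" using yT(7) by (auto simp: P_def g1 g2)
    ultimately have "card (P g1 \<union> P g2) = card (P g1) + card (P g2)"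
      by (simp add: card_Un_disjoint)
    also have "\<dots> = fact (k - 2) * (2 * 2 ^ (k - 2)) * fact (card A - 3 - 2 * (k - 2))"
      unfolding cP by simp
    also have "2 * 2 ^ (k - 2) = (2::nat) ^ (k - 1)"
      using assms(2) by (cases k) (auto simp: Suc_diff_le power_Suc[symmetric] simp del: power_Suc)
    also have "card A - 3 - 2 * (k - 2) = card A + 1 - 2 * k" using assms(2) by simp
    finally show ?thesis unfolding eq .
  qed
  then show ?thesis by (simp add: card_N_eq_sum[OF assms(1)])
qed

definition nbrs :: "'a \<Rightarrow> 'a set" where "nbrs u = {v. {u, v} \<in> E ` D}"

text \<open>Besides \<open>s u\<close> only a predecessor of \<open>u\<close> can be a neighbour,
  and injectivity of \<open>s\<close> leaves at most one. This is the source of the factor 2 per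
  edge in \<open>card_G_le\<close>.\<close>

lemma nbrs: "finite (nbrs u)" "card (nbrs u) \<le> 2"
proof -
  have sub: "nbrs u \<subseteq> insert (s u) {v \<in> D. s v = u}"
    by (auto simp: nbrs_def E_def doubleton_eq_iff)
  have fin: "finite {v \<in> D. s v = u}" using finite_D by simp
  have one: "card {v \<in> D. s v = u} \<le> Suc 0"
    using fin s_eq_iff by (auto simp: card_le_Suc0_iff_eq)
  show "finite (nbrs u)" using sub fin finite_subset by blast
  have "card (nbrs u) \<le> card (insert (s u) {v \<in> D. s v = u})" using sub fin by (intro card_mono) auto
  also have "\<dots> \<le> Suc (card {v \<in> D. s v = u})" by (rule card_insert_le_m1[of "Suc (card {v \<in> D. s v = u})", simplified]) simp
  finally show "card (nbrs u) \<le> 2" using one by simp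
qed

text \<open>The ways in which members of \<open>N S\<close> can act on the vertices touched by
  \<open>S\<close>. \<open>restrict\<close> erases the values elsewhere, so that equal actions are
  equal functions.\<close>

definition G :: "'a set \<Rightarrow> ('a \<Rightarrow> 'a) set" where
  "G S = (\<lambda>p. restrict p (\<Union>(E ` S))) ` N S"

lemma finite_N: "finite (N S)"
  by (rule finite_subset[OF _ finite_perms]) (auto simp: N_def)

text \<open>Adding an edge at the end of a path leaves two choices for its image; starting a new path
  leaves \<open>card A\<close> choices for one endpoint and then two for the other. The missing cycles provide
  an edge whose successor is not in the set.\<close>

lemma card_G_le:
  assumes "S \<subseteq> D" "card S < card A"
  shows "card (G S) \<le> 2 ^ card S * card A ^ (card S - card (adj S))"
  using assms
proof (induction "card S" arbitrary: S)
  case 0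
  then have "S = {}" using finite_sub by auto
  then have "G S \<subseteq> {\<lambda>_. undefined}" by (auto simp: G_def)
  then have "card (G S) \<le> card {\<lambda>_::'a. undefined::'a}" by (intro card_mono) auto
  then show ?case by (simp add: \<open>S = {}\<close> adj_def)
next
  case (Suc k)
  have finS: "finite S" using finite_sub Suc.prems by blast
  \<comment> \<open>As \<open>e\<close> is the last edge of its path, its removal destroys at most
    one adjacent pair, the one with its predecessor. The hypothesis \<open>card S < card A\<close>
    excludes the full cycle.\<close>
  have "\<exists>e\<in>S. s e \<notin> S"
    using Suc.prems Suc.hyps(2) by (intro no_proper_cycle) auto
  then obtain e where e: "e \<in> S" "s e \<notin> S" by blast
  define S' where "S' = S - {e}"
  have S': "card S' = k" "S' \<subseteq> D" "S = insert e S'" "e \<notin> S'"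
    using e Suc.hyps(2) Suc.prems finS by (auto simp: S'_def)
  have IH: "card (G S') \<le> 2 ^ k * card A ^ (k - card (adj S'))"
    using Suc.hyps(1)[of S'] S' Suc.prems(2) Suc.hyps(2) by simp
  let ?V = "\<Union>(E ` S)" and ?V' = "\<Union>(E ` S')"
  have finG: "finite (G S')" using finite_N by (simp add: G_def)
  have N_sub: "N S \<subseteq> N S'" using S' by (auto simp: N_def)
  have V: "?V = ?V' \<union> {e, s e}" unfolding S'(3) by (auto simp: E_def)
  have nb: "p (s e) \<in> nbrs (p e)" if "p \<in> N S" for p
    using that e by (auto simp: N_def bad_def nbrs_def E_def)
  have eD: "e \<in> D" using e Suc.prems by blast
  show ?case
  proof (cases "e \<in> s ` S'")
    case True
    then obtain x where x: "x \<in> S'" "s x = e" by blast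
    have "adj S = insert x (adj S')"
    proof -
      have "z = x" if "z \<in> S" "s z = e" for z
        using that x s_eq_iff[of z x] Suc.prems S' by auto
      then show ?thesis using e x S' by (auto simp: adj_def)
    qed
    moreover have "x \<notin> adj S'" using x S'(4) by (auto simp: adj_def)
    moreover have "finite (adj S')" using S' finS by (auto simp: adj_def)
    ultimately have W: "card (adj S) = Suc (card (adj S'))" by simp
    have eV: "e \<in> ?V'" using x by (auto simp: E_def)
    define \<Phi> where "\<Phi> g = (\<lambda>v. restrict (g(s e := v)) ?V) ` nbrs (g e)" for g
    have "G S \<subseteq> (\<Union>g\<in>G S'. \<Phi> g)"
    proof
      fix h assume "h \<in> G S"
      then obtain p where p: "p \<in> N S" "h = restrict p ?V" by (auto simp: G_def)
      let ?g = "restrict p ?V'"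
      have "?g \<in> G S'" using p N_sub by (auto simp: G_def)
      moreover have "h = restrict (?g(s e := p (s e))) ?V"
        unfolding p(2) V using eV by (auto simp: fun_eq_iff restrict_def)
      moreover have "p (s e) \<in> nbrs (?g e)" using nb[OF p(1)] eV by simp
      ultimately show "h \<in> (\<Union>g\<in>G S'. \<Phi> g)" unfolding \<Phi>_def by blast
    qed
    then have "card (G S) \<le> card (\<Union>g\<in>G S'. \<Phi> g)"
      using finG nbrs(1) by (intro card_mono) (auto simp: \<Phi>_def)
    also have "\<dots> \<le> (\<Sum>g\<in>G S'. card (\<Phi> g))" using finG by (rule card_UN_le)
    also have "\<dots> \<le> (\<Sum>g\<in>G S'. 2)"
      unfolding \<Phi>_def using nbrs card_image_le order_trans by (intro sum_mono) blast
    also have "\<dots> \<le> 2 * (2 ^ k * card A ^ (k - card (adj S')))" using IH by simp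
    finally show ?thesis using W Suc.hyps(2) by (simp add: mult.assoc flip: Suc.hyps(2))
  next
    case False
    have "adj S = adj S'" using e False S' by (auto simp: adj_def)
    moreover have "card (adj S') \<le> k" using card_adj_le[OF S'(2)] S'(1) by simp
    ultimately have W: "card S - card (adj S) = Suc (k - card (adj S'))"
      using Suc.hyps(2) by simp
    define \<Phi> where "\<Phi> g = (\<Union>u\<in>A. (\<lambda>v. restrict (g(e := u, s e := v)) ?V) ` nbrs u)" for g
    have "G S \<subseteq> (\<Union>g\<in>G S'. \<Phi> g)"
    proof
      fix h assume "h \<in> G S"
      then obtain p where p: "p \<in> N S" "h = restrict p ?V" by (auto simp: G_def)
      let ?g = "restrict p ?V'"
      have "?g \<in> G S'" using p N_sub by (auto simp: G_def)
      moreover have "h = restrict (?g(e := p e, s e := p (s e))) ?V"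
        unfolding p(2) V by (auto simp: fun_eq_iff restrict_def)
      moreover have "p e \<in> A" using p(1) eD D_subset permutes_in_image[of p A e] by (auto simp: N_def)
      ultimately show "h \<in> (\<Union>g\<in>G S'. \<Phi> g)" unfolding \<Phi>_def using nb[OF p(1)] by blast
    qed
    then have "card (G S) \<le> card (\<Union>g\<in>G S'. \<Phi> g)"
      using finG nbrs(1) finite_A by (intro card_mono) (auto simp: \<Phi>_def)
    also have "\<dots> \<le> (\<Sum>g\<in>G S'. card (\<Phi> g))" using finG by (rule card_UN_le)
    also have "\<dots> \<le> (\<Sum>g\<in>G S'. card A * 2)"
    proof (rule sum_mono)
      fix g
      have "card (\<Phi> g) \<le> (\<Sum>u\<in>A. card ((\<lambda>v. restrict (g(e := u, s e := v)) ?V) ` nbrs u))"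
        unfolding \<Phi>_def using finite_A by (rule card_UN_le)
      also have "\<dots> \<le> (\<Sum>u\<in>A. 2)"
        using nbrs card_image_le order_trans by (intro sum_mono) blast
      finally show "card (\<Phi> g) \<le> card A * 2" by simp
    qed
    also have "\<dots> \<le> (2 ^ k * card A ^ (k - card (adj S'))) * (card A * 2)"
      using IH by simp
    finally show ?thesis unfolding W unfolding Suc.hyps(2)[symmetric] by (simp add: mult_ac)
  qed
qed

text \<open>An action on the touched vertices pins \<open>2 * card S - card (adj S)\<close> values,
  and \<open>card_permutes_pinned\<close> counts its extensions. Unlike the two exact counts, this
  holds for any number of adjacent pairs.\<close>

lemma card_N_le:
  assumes "S \<subseteq> D" "card S < card A"
  shows "card (N S) \<le> 2 ^ card S * card A ^ (card S - card (adj S)) * fact (card A - (2 * card S - card (adj S)))"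
proof -
  let ?V = "\<Union>(E ` S)"
  have "N S = (\<Union>g\<in>G S. {p \<in> N S. restrict p ?V = g})" by (auto simp: G_def)
  then have "card (N S) \<le> (\<Sum>g\<in>G S. card {p \<in> N S. restrict p ?V = g})"
    using card_UN_le[of "G S" "\<lambda>g. {p \<in> N S. restrict p ?V = g}"] finite_N by (simp add: G_def)
  also have "\<dots> \<le> (\<Sum>g\<in>G S. fact (card A - card ?V))"
  proof (rule sum_mono)
    fix g assume "g \<in> G S"
    then obtain q where q: "q \<in> N S" "g = restrict q ?V" by (auto simp: G_def)
    have qA: "q permutes A" using q(1) by (simp add: N_def)
    have "card {p \<in> N S. restrict p ?V = g} \<le> card {p. p permutes A \<and> (\<forall>v\<in>?V. p v = q v)}"
    proof (rule card_mono)
      show "finite {p. p permutes A \<and> (\<forall>v\<in>?V. p v = q v)}"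
        by (rule finite_subset[OF _ finite_perms]) auto
      show "{p \<in> N S. restrict p ?V = g} \<subseteq> {p. p permutes A \<and> (\<forall>v\<in>?V. p v = q v)}"
      proof
        fix p assume "p \<in> {p \<in> N S. restrict p ?V = g}"
        then have p: "p \<in> N S" "restrict p ?V = g" by blast+
        have "p v = q v" if "v \<in> ?V" for v
          using fun_cong[OF p(2)[unfolded q(2)], of v] that by (simp only: restrict_apply if_True)
        moreover have "p permutes A" using p(1) by (simp add: N_def)
        ultimately show "p \<in> {p. p permutes A \<and> (\<forall>v\<in>?V. p v = q v)}" by blast
      qed
    qed
    also have "\<dots> = fact (card A - card ?V)"
      using Union_E_subset[OF assms(1)] permutes_inj_on[OF qA] permutes_image[OF qA]
      by (intro card_permutes_pinned[OF finite_A]) (auto simp: permutes_in_image[OF qA])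
    finally show "card {p \<in> N S. restrict p ?V = g} \<le> fact (card A - card ?V)" .
  qed
  also have "\<dots> = card (G S) * fact (card A - card ?V)" by simp
  also have "\<dots> \<le> 2 ^ card S * card A ^ (card S - card (adj S)) * fact (card A - card ?V)"
    by (intro mult_right_mono card_G_le assms) simp
  also have "card ?V = 2 * card S - card (adj S)" using card_Union_E[OF assms(1)] by simp
  finally show ?thesis .
qed

end

section \<open>Bonferroni inequality and counting supersets of fixed size\<close>

lemma bonferroni_sum:
  "(\<Sum>k<Suc m. (-1) ^ k * real (Suc x choose k)) = (-1) ^ m * real (x choose m)"
  by (induction m) (simp_all add: algebra_simps)

text \<open>For positive \<open>x\<close> the truncated sum is, up to sign,
  \<open>(x - 1) choose (K - 1)\<close>, which by Pascal's rule is a summand of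
  \<open>x choose K\<close>.\<close>

lemma bonferroni:
  assumes "0 < K"
  shows "\<bar>of_bool (x = 0) - (\<Sum>k<K. (-1) ^ k * real (x choose k))\<bar> \<le> real (x choose K)"
proof -
  obtain m where m: "K = Suc m" using assms gr0_implies_Suc by blast
  show ?thesis
  proof (cases x)
    case 0
    have "(\<Sum>k<K. (-1) ^ k * real (0 choose k)) = (\<Sum>k<K. of_bool (k = 0))"
      by (intro sum.cong) (auto simp: binomial_eq_0)
    also have "\<dots> = 1" using assms by (simp add: of_bool_def)
    finally show ?thesis using 0 by simp
  next
    case (Suc y)
    then show ?thesis unfolding m Suc bonferroni_sum by (simp add: abs_mult power_abs)
  qed
qed

lemma card_supersets:
  assumes "finite D" "U \<subseteq> D" "card U \<le> k"
  shows "card {S. S \<subseteq> D \<and> card S = k \<and> U \<subseteq> S} = (card D - card U) choose (k - card U)"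
proof -
  have finU: "finite U" using assms finite_subset by blast
  have "bij_betw (\<lambda>R. U \<union> R) {R. R \<subseteq> D - U \<and> card R = k - card U} {S. S \<subseteq> D \<and> card S = k \<and> U \<subseteq> S}"
  proof (rule bij_betwI[where g = "\<lambda>S. S - U"])
    show "(\<lambda>R. U \<union> R) \<in> {R. R \<subseteq> D - U \<and> card R = k - card U} \<rightarrow> {S. S \<subseteq> D \<and> card S = k \<and> U \<subseteq> S}"
    proof
      fix R assume R: "R \<in> {R. R \<subseteq> D - U \<and> card R = k - card U}"
      then have "finite R" "U \<inter> R = {}" using assms(1) by (auto intro: finite_subset)
      then have "card (U \<union> R) = k" using R finU assms(3) by (simp add: card_Un_disjoint)
      then show "U \<union> R \<in> {S. S \<subseteq> D \<and> card S = k \<and> U \<subseteq> S}" using R assms(2) by auto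
    qed
    show "(\<lambda>S. S - U) \<in> {S. S \<subseteq> D \<and> card S = k \<and> U \<subseteq> S} \<rightarrow> {R. R \<subseteq> D - U \<and> card R = k - card U}"
      using finU by (auto simp: card_Diff_subset)
  qed auto
  then have "card {S. S \<subseteq> D \<and> card S = k \<and> U \<subseteq> S} = card {R. R \<subseteq> D - U \<and> card R = k - card U}"
    by (simp add: bij_betw_same_card)
  also have "\<dots> = (card D - card U) choose (k - card U)"
    using assms finU by (simp add: n_subsets card_Diff_subset)
  finally show ?thesis .
qed

lemma card_supersets_eq_0:
  assumes "finite D" "U \<subseteq> D" "k < card U"
  shows "card {S. S \<subseteq> D \<and> card S = k \<and> U \<subseteq> S} = 0"
proof -
  have "\<not> U \<subseteq> S" if "S \<subseteq> D" "card S = k" for S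
    using card_mono[of S U] finite_subset[of S D] assms that by auto
  then have "{S. S \<subseteq> D \<and> card S = k \<and> U \<subseteq> S} = {}" by blast
  then show ?thesis by (simp only: card.empty)
qed

text \<open>The factor \<open>fact k / n ^ k\<close> gives the family of all
  \<open>k\<close>-subsets total weight at most 1 (the case of empty \<open>U\<close>). Each
  prescribed element then costs a factor \<open>k / n\<close>, as for a random
  \<open>k\<close>-subset.\<close>

lemma card_supersets_le:
  assumes "finite D" "U \<subseteq> D" "card D \<le> n" "0 < n"
  shows "real (card {S. S \<subseteq> D \<and> card S = k \<and> U \<subseteq> S}) * fact k / real n ^ k \<le> (real k / real n) ^ card U"
proof (cases "card U \<le> k")
  case True
  define u where "u = card U"
  have u: "u \<le> k" using True by (simp add: u_def)
  have "((card D - u) choose (k - u)) * fact (k - u) \<le> n ^ (k - u)"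
  proof -
    have "((card D - u) choose (k - u)) * fact (k - u) \<le> (card D - u) ^ (k - u)"
      by (rule binomial_fact_pow)
    also have "\<dots> \<le> n ^ (k - u)" using assms(3) by (intro power_mono) auto
    finally show ?thesis .
  qed
  moreover have "fact k \<le> fact (k - u) * k ^ u"
    using fact_div_fact_le_pow[OF u] u
    by (metis dvd_div_mult_self fact_dvd diff_le_self mult.commute mult_le_mono2)
  ultimately have "((card D - u) choose (k - u)) * fact k \<le> n ^ (k - u) * k ^ u"
  proof -
    assume a: "((card D - u) choose (k - u)) * fact (k - u) \<le> n ^ (k - u)" and b: "fact k \<le> fact (k - u) * k ^ u"
    have "((card D - u) choose (k - u)) * fact k \<le> ((card D - u) choose (k - u)) * fact (k - u) * k ^ u"
      using mult_left_mono[OF b, of "(card D - u) choose (k - u)"] by (simp add: mult.assoc)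
    also have "\<dots> \<le> n ^ (k - u) * k ^ u" using a by (rule mult_right_mono) simp
    finally show ?thesis .
  qed
  then have *: "real ((card D - u) choose (k - u)) * fact k \<le> real n ^ (k - u) * real k ^ u"
    by (metis of_nat_fact of_nat_le_iff of_nat_mult of_nat_power)
  have eq: "real n ^ k = real n ^ (k - u) * real n ^ u" using u by (simp flip: power_add)
  have "real ((card D - u) choose (k - u)) * fact k / real n ^ k
     \<le> (real n ^ (k - u) * real k ^ u) / (real n ^ (k - u) * real n ^ u)"
    unfolding eq using * by (intro divide_right_mono) simp_all
  also have "\<dots> = (real k / real n) ^ u" using assms(4) by (simp add: power_divide)
  finally show ?thesis using card_supersets[OF assms(1,2) True] by (simp add: u_def)
next
  case False
  then have "card {S. S \<subseteq> D \<and> card S = k \<and> U \<subseteq> S} = 0"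
    by (intro card_supersets_eq_0 assms) simp
  then show ?thesis by (simp only: of_nat_0) simp
qed

text \<open>An exact value is needed here because the expected number of adjacent pairs enters the
  first-order term. It comes from absorbing a factor into the binomial coefficient twice; for
  \<open>k < 2\<close> both sides vanish.\<close>

lemma card_supersets_two:
  assumes "finite D" "U \<subseteq> D" "card U = 2"
  shows "real (card {S. S \<subseteq> D \<and> card S = k \<and> U \<subseteq> S})
     = real k * (real k - 1) / (real (card D) * (real (card D) - 1)) * real (card D choose k)"
proof (cases "2 \<le> k")
  case True
  define m where "m = card D"
  have m: "2 \<le> m" using assms card_mono[OF assms(1,2)] by (simp add: m_def)
  obtain j where j: "k = Suc (Suc j)" using True by (auto simp: numeral_2_eq_2 Suc_le_eq gr0_conv_Suc dest!: less_imp_Suc_add)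
  obtain l where l: "m = Suc (Suc l)" using m by (auto simp: numeral_2_eq_2 Suc_le_eq gr0_conv_Suc dest!: less_imp_Suc_add)
  have "Suc (Suc j) * (Suc (Suc l) choose Suc (Suc j)) = Suc (Suc l) * (Suc l choose Suc j)"
    by (rule Suc_times_binomial)
  moreover have "Suc j * (Suc l choose Suc j) = Suc l * (l choose j)"
    by (rule Suc_times_binomial)
  ultimately have "Suc j * (Suc (Suc j) * (Suc (Suc l) choose Suc (Suc j))) = Suc (Suc l) * (Suc l * (l choose j))"
    by (metis mult.left_commute)
  then have "real (Suc j) * (real (Suc (Suc j)) * real (Suc (Suc l) choose Suc (Suc j)))
      = real (Suc (Suc l)) * (real (Suc l) * real (l choose j))"
    by (metis of_nat_mult)
  moreover have "card {S. S \<subseteq> D \<and> card S = k \<and> U \<subseteq> S} = l choose j"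
    using card_supersets[OF assms(1,2)] assms(3) True j l by (simp add: m_def)
  moreover have "real m = real (Suc (Suc l))" "real m - 1 = real (Suc l)" "real k = real (Suc (Suc j))" "real k - 1 = real (Suc j)"
    using j l by simp_all
  ultimately have "(real k - 1) * (real k * real (m choose k))
        = real m * ((real m - 1) * real (card {S. S \<subseteq> D \<and> card S = k \<and> U \<subseteq> S}))"
    by (simp only: j l)
  moreover have "real m * (real m - 1) \<noteq> 0" using m by simp
  ultimately show ?thesis
    unfolding m_def[symmetric] by (simp add: eq_divide_eq mult_ac)
next
  case False
  then have "k = 0 \<or> k = 1" by auto
  moreover have "card {S. S \<subseteq> D \<and> card S = k \<and> U \<subseteq> S} = 0"
    using assms(3) False by (intro card_supersets_eq_0 assms) simp
  ultimately show ?thesis by (elim disjE) (simp_all only: of_nat_0 of_nat_1, simp_all)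
qed

section \<open>Binomial moments of bad edges and moments of adjacent pairs\<close>

context successor
begin

definition Sub :: "nat \<Rightarrow> 'a set set" where "Sub k = {S. S \<subseteq> D \<and> card S = k}"

text \<open>The \<open>k\<close>-th binomial moment of the number of bad edges, summed over all
  permutations instead of averaged.\<close>

definition M :: "nat \<Rightarrow> nat" where "M k = (\<Sum>S\<in>Sub k. card (N S))"

text \<open>The starting points of paths of two edges, that is, all possible elements of
  \<open>adj S\<close>.\<close>

definition D2 :: "'a set" where "D2 = {x \<in> D. s x \<in> D}"

lemma finite_Sub: "finite (Sub k)"
  by (rule finite_subset[of _ "Pow D"]) (auto simp: Sub_def finite_D)

lemma finite_D2: "finite D2"
  using finite_D by (simp add: D2_def)

text \<open>Double counting of the pairs of a permutation and a \<open>k\<close>-subset of its bad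
  edges.\<close>

lemma M_eq: "M k = (\<Sum>p | p permutes A. card (bad p) choose k)"
proof -
  have "card (N S) = (\<Sum>p | p permutes A. of_bool (S \<subseteq> bad p))" for S
    using finite_perms by (simp add: N_def Collect_conj_eq)
  then have "M k = (\<Sum>S\<in>Sub k. \<Sum>p | p permutes A. of_bool (S \<subseteq> bad p))"
    by (simp add: M_def)
  also have "\<dots> = (\<Sum>p | p permutes A. \<Sum>S\<in>Sub k. of_bool (S \<subseteq> bad p))"
    by (rule sum.swap)
  also have "\<dots> = (\<Sum>p | p permutes A. card (bad p) choose k)"
  proof (rule sum.cong[OF refl])
    fix p
    have b: "bad p \<subseteq> D" by (auto simp: bad_def)
    have "(\<Sum>S\<in>Sub k. of_bool (S \<subseteq> bad p)) = card (Sub k \<inter> {S. S \<subseteq> bad p})"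
      using finite_Sub by simp
    also have "Sub k \<inter> {S. S \<subseteq> bad p} = {S. S \<subseteq> bad p \<and> card S = k}" using b by (auto simp: Sub_def)
    also have "card \<dots> = card (bad p) choose k" by (rule n_subsets[OF finite_sub[OF b]])
    finally show "(\<Sum>S\<in>Sub k. of_bool (S \<subseteq> bad p)) = card (bad p) choose k" .
  qed
  finally show ?thesis .
qed

lemma bonferroni_bad:
  assumes "0 < K"
  shows "\<bar>real (card {p. p permutes A \<and> bad p = {}}) - (\<Sum>k<K. (-1) ^ k * real (M k))\<bar> \<le> real (M K)"
proof -
  have fin: "finite (bad p)" for p by (rule finite_sub) (auto simp: bad_def)
  let ?P = "{p. p permutes A}"
  have "real (card {p. p permutes A \<and> bad p = {}}) = (\<Sum>p\<in>?P. of_bool (card (bad p) = 0))"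
    using finite_perms fin by (simp add: Collect_conj_eq)
  moreover have "(\<Sum>k<K. (-1) ^ k * real (M k)) = (\<Sum>p\<in>?P. \<Sum>k<K. (-1) ^ k * real (card (bad p) choose k))"
    unfolding M_eq of_nat_sum sum_distrib_left by (rule sum.swap)
  ultimately have "\<bar>real (card {p. p permutes A \<and> bad p = {}}) - (\<Sum>k<K. (-1) ^ k * real (M k))\<bar>
     = \<bar>\<Sum>p\<in>?P. of_bool (card (bad p) = 0) - (\<Sum>k<K. (-1) ^ k * real (card (bad p) choose k))\<bar>"
    by (simp add: sum_subtractf)
  also have "\<dots> \<le> (\<Sum>p\<in>?P. real (card (bad p) choose K))"
    by (rule order_trans[OF sum_abs]) (intro sum_mono bonferroni assms)
  finally show ?thesis by (simp add: M_eq)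
qed

definition path2 :: "'a \<Rightarrow> 'a set \<Rightarrow> real" where "path2 x S = of_bool ({x, s x} \<subseteq> S)"

lemma card_adj_eq_sum:
  assumes "S \<subseteq> D"
  shows "real (card (adj S)) = (\<Sum>x\<in>D2. path2 x S)"
proof -
  have "adj S = D2 \<inter> {x. {x, s x} \<subseteq> S}" using assms by (auto simp: adj_def D2_def)
  then show ?thesis using finite_D2 by (simp add: path2_def)
qed

lemma sum_path2_eq:
  "(\<Sum>S\<in>Sub k. of_bool (U \<subseteq> S)) = real (card {S. S \<subseteq> D \<and> card S = k \<and> U \<subseteq> S})"
proof -
  have "Sub k \<inter> {S. U \<subseteq> S} = {S. S \<subseteq> D \<and> card S = k \<and> U \<subseteq> S}" by (auto simp: Sub_def)
  then show ?thesis using finite_Sub[of k] by simp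
qed

text \<open>First moment by linearity: each path of two edges contributes the number of
  \<open>k\<close>-sets that contain both its edges.\<close>

lemma sum_card_adj:
  "(\<Sum>S\<in>Sub k. real (card (adj S)))
     = real (card D2) * (real k * (real k - 1) / (real (card D) * (real (card D) - 1))) * real (card D choose k)"
proof -
  have "(\<Sum>S\<in>Sub k. real (card (adj S))) = (\<Sum>S\<in>Sub k. \<Sum>x\<in>D2. path2 x S)"
    by (rule sum.cong) (auto simp: Sub_def card_adj_eq_sum)
  also have "\<dots> = (\<Sum>x\<in>D2. \<Sum>S\<in>Sub k. path2 x S)" by (rule sum.swap)
  also have "\<dots> = (\<Sum>x\<in>D2. real k * (real k - 1) / (real (card D) * (real (card D) - 1)) * real (card D choose k))"
  proof (rule sum.cong[OF refl])
    fix x assume "x \<in> D2"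
    then have x: "x \<in> D" "s x \<in> D" by (auto simp: D2_def)
    then have "card {x, s x} = 2" using card_E by (simp add: E_def)
    then show "(\<Sum>S\<in>Sub k. path2 x S) = real k * (real k - 1) / (real (card D) * (real (card D) - 1)) * real (card D choose k)"
      unfolding path2_def sum_path2_eq using x finite_D by (intro card_supersets_two) auto
  qed
  finally show ?thesis by (simp add: mult.assoc)
qed

text \<open>Two distinct adjacent pairs involve at least three edges, and four unless they overlap.
  These counts become the exponents of \<open>k / n\<close> in the second factorial moment.\<close>

lemma card_two_paths:
  assumes "x \<in> D2" "y \<in> D2" "x \<noteq> y"
  shows "3 \<le> card {x, s x, y, s y}" "y \<noteq> s x \<Longrightarrow> x \<noteq> s y \<Longrightarrow> card {x, s x, y, s y} = 4"
proof -
  have D: "x \<in> D" "s x \<in> D" "y \<in> D" "s y \<in> D" using assms by (auto simp: D2_def)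
  have ne: "s x \<noteq> x" "s y \<noteq> y" "s x \<noteq> s y"
    using s_neq D(1,3) s_eq_iff[OF D(1,3)] assms(3) by auto
  show "card {x, s x, y, s y} = 4" if "y \<noteq> s x" "x \<noteq> s y"
    using ne that assms(3) by simp
  show "3 \<le> card {x, s x, y, s y}"
  proof (cases "y = s x")
    case True
    have "s y \<noteq> x" using s_s_neq[OF D(1,2)] True by simp
    then have "card {x, s x, s y} = 3" using ne by simp
    moreover have "card {x, s x, s y} \<le> card {x, s x, y, s y}" by (intro card_mono) auto
    ultimately show ?thesis by simp
  next
    case False
    then have "card {x, s x, y} = 3" using ne assms(3) by auto
    moreover have "card {x, s x, y} \<le> card {x, s x, y, s y}" by (intro card_mono) auto
    ultimately show ?thesis by simp
  qed
qed

text \<open>The second factorial moment is a sum over ordered pairs of distinct paths. At most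
  \<open>2 * n\<close> of these pairs overlap and weigh at most \<open>(k / n) ^ 3\<close> each; the
  others, at most \<open>n ^ 2\<close> of them, weigh at most \<open>(k / n) ^ 4\<close>. The total
  is at most \<open>(2 * k ^ 3 + k ^ 4) / n ^ 2\<close>.\<close>

lemma sum_card_adj_pairs:
  assumes n: "n = card A" and k: "k \<le> n"
  shows "(\<Sum>S\<in>Sub k. real (card (adj S)) * (real (card (adj S)) - 1)) * fact k / real n ^ k
          \<le> 3 * real k ^ 4 / real n ^ 2"
proof -
  define q where "q = real k / real n"
  have n0: "0 < n" using card_A n by simp
  have q: "0 \<le> q" "q \<le> 1" using k n0 by (auto simp: q_def)
  have D2n: "card D2 \<le> n" unfolding n using D_subset by (intro card_mono finite_A) (auto simp: D2_def)
  let ?f = "\<lambda>x y. (\<Sum>S\<in>Sub k. of_bool (x \<noteq> y) * (path2 x S * path2 y S)) * fact k / real n ^ k"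
  have pairs: "real (card (adj S)) * (real (card (adj S)) - 1)
      = (\<Sum>x\<in>D2. \<Sum>y\<in>D2. of_bool (x \<noteq> y) * (path2 x S * path2 y S))" if "S \<in> Sub k" for S
  proof -
    have S: "real (card (adj S)) = (\<Sum>x\<in>D2. path2 x S)" using that by (simp add: Sub_def card_adj_eq_sum)
    have "(\<Sum>x\<in>D2. \<Sum>y\<in>D2. of_bool (x \<noteq> y) * (path2 x S * path2 y S))
       = (\<Sum>x\<in>D2. \<Sum>y\<in>D2. path2 x S * path2 y S - (if x = y then path2 x S else 0))"
      by (intro sum.cong refl) (auto simp: path2_def)
    also have "\<dots> = (\<Sum>x\<in>D2. path2 x S) * (\<Sum>x\<in>D2. path2 x S) - (\<Sum>x\<in>D2. path2 x S)"
      using finite_D2 by (simp add: sum_subtractf sum_product)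
    finally show ?thesis by (simp add: S algebra_simps)
  qed
  have bound: "?f x y \<le> (of_bool (y = s x) + of_bool (x = s y)) * q ^ 3 + q ^ 4" if xy: "x \<in> D2" "y \<in> D2" for x y
  proof (cases "x = y")
    case True
    then show ?thesis using q by simp
  next
    case False
    have D: "{x, s x, y, s y} \<subseteq> D" using xy by (auto simp: D2_def)
    have "of_bool (x \<noteq> y) * (path2 x S * path2 y S) = of_bool ({x, s x, y, s y} \<subseteq> S)" for S
      using False by (auto simp: path2_def)
    then have "?f x y = real (card {S. S \<subseteq> D \<and> card S = k \<and> {x, s x, y, s y} \<subseteq> S}) * fact k / real n ^ k"
      by (simp only: sum_path2_eq)
    also have "\<dots> \<le> q ^ card {x, s x, y, s y}"
      unfolding q_def using D finite_D D_subset finite_A n n0 by (intro card_supersets_le) (auto intro: card_mono)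
    also have "\<dots> \<le> (of_bool (y = s x) + of_bool (x = s y)) * q ^ 3 + q ^ 4"
    proof (cases "y = s x \<or> x = s y")
      case True
      have "q ^ card {x, s x, y, s y} \<le> q ^ 3"
        using card_two_paths(1)[OF xy False] q by (intro power_decreasing) auto
      also have "\<dots> \<le> (of_bool (y = s x) + of_bool (x = s y)) * q ^ 3"
        using True q mult_right_mono[of 1 "of_bool (y = s x) + of_bool (x = s y)" "q ^ 3"] by auto
      finally show ?thesis using q by (smt (verit) zero_le_power)
    next
      case False
      then show ?thesis using card_two_paths(2)[OF xy \<open>x \<noteq> y\<close>] q by simp
    qed
    finally show ?thesis .
  qed
  have one: "(\<Sum>y\<in>D2. of_bool (y = s x)) \<le> (1::real)" for x
    using finite_D2 by (simp add: of_bool_def sum.delta)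
  have one': "(\<Sum>x\<in>D2. of_bool (x = s y)) \<le> (1::real)" for y
    using finite_D2 by (simp add: of_bool_def sum.delta)
  have "(\<Sum>S\<in>Sub k. real (card (adj S)) * (real (card (adj S)) - 1)) * fact k / real n ^ k
      = (\<Sum>x\<in>D2. \<Sum>y\<in>D2. ?f x y)"
  proof -
    have "(\<Sum>S\<in>Sub k. real (card (adj S)) * (real (card (adj S)) - 1))
        = (\<Sum>S\<in>Sub k. \<Sum>x\<in>D2. \<Sum>y\<in>D2. of_bool (x \<noteq> y) * (path2 x S * path2 y S))"
      using pairs by (rule sum.cong[OF refl])
    also have "\<dots> = (\<Sum>x\<in>D2. \<Sum>S\<in>Sub k. \<Sum>y\<in>D2. of_bool (x \<noteq> y) * (path2 x S * path2 y S))"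
      by (rule sum.swap)
    also have "\<dots> = (\<Sum>x\<in>D2. \<Sum>y\<in>D2. \<Sum>S\<in>Sub k. of_bool (x \<noteq> y) * (path2 x S * path2 y S))"
      by (intro sum.cong refl sum.swap)
    finally show ?thesis by (simp only: sum_distrib_right sum_divide_distrib)
  qed
  also have "\<dots> \<le> (\<Sum>x\<in>D2. \<Sum>y\<in>D2. (of_bool (y = s x) + of_bool (x = s y)) * q ^ 3 + q ^ 4)"
    by (intro sum_mono bound)
  also have "\<dots> = (\<Sum>x\<in>D2. \<Sum>y\<in>D2. of_bool (y = s x)) * q ^ 3 + (\<Sum>y\<in>D2. \<Sum>x\<in>D2. of_bool (x = s y)) * q ^ 3
        + real (card D2) * real (card D2) * q ^ 4"
    by (simp add: sum.distrib distrib_right sum_distrib_right sum.swap[of "\<lambda>x y. of_bool (x = s y) * q ^ 3"])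
  also have "\<dots> \<le> (\<Sum>x\<in>D2. 1) * q ^ 3 + (\<Sum>y\<in>D2. 1) * q ^ 3 + real (card D2) * real (card D2) * q ^ 4"
    using q by (intro add_mono mult_right_mono sum_mono one one' order_refl) auto
  also have "\<dots> = 2 * real (card D2) * q ^ 3 + real (card D2) * real (card D2) * q ^ 4" by simp
  also have "\<dots> \<le> 2 * real n * q ^ 3 + real n * real n * q ^ 4"
    using D2n q by (intro add_mono mult_right_mono mult_mono mult_left_mono) auto
  also have "\<dots> = (2 * real k ^ 3 + real k ^ 4) / real n ^ 2"
    using n0 by (simp add: q_def power_divide field_simps eval_nat_numeral)
  also have "\<dots> \<le> 3 * real k ^ 4 / real n ^ 2"
  proof -
    have "real k ^ 3 \<le> real k ^ 4" by (cases k) (auto intro: power_increasing)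
    then show ?thesis by (intro divide_right_mono) auto
  qed
  finally show ?thesis .
qed

end

section \<open>Splitting a binomial moment by the number of adjacent pairs\<close>

text \<open>Each step of the exponent trades a factor \<open>n - i\<close> for \<open>n\<close>.
  Hence edge sets touching fewer than \<open>2 * k\<close> vertices have a normalised count no
  larger than in the case without pairs.\<close>

lemma power_fact_mono:
  assumes "v \<le> w" "w \<le> n"
  shows "real n ^ v * fact (n - v) \<le> real n ^ w * fact (n - w)"
  using assms
proof (induction w rule: dec_induct)
  case (step i)
  have "fact (n - i) = real (n - i) * fact (n - Suc i)"
    using step by (subst fact_reduce) auto
  also have "\<dots> \<le> real n * fact (n - Suc i)" by (intro mult_right_mono) auto
  finally have "real n ^ i * fact (n - i) \<le> real n ^ i * (real n * fact (n - Suc i))"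
    by (rule mult_left_mono) simp
  also have "\<dots> = real n ^ Suc i * fact (n - Suc i)" by simp
  finally show ?case using step.IH step.prems by linarith
qed simp

context successor
begin

text \<open>Here \<open>c0\<close> and \<open>c1\<close> are the normalised numbers of edge sets of size \<open>k\<close> with no and with
  exactly one adjacent pair, and \<open>r\<close> is the contribution of all other edge sets. The expected number of
  pairs gives \<open>c1\<close> up to its second factorial moment, which is at most \<open>Z\<close>.\<close>

lemma M_decomposition:
  fixes n k :: nat
  defines "n \<equiv> card A"
  defines "t \<equiv> real (card D choose k) * fact k / real n ^ k"
  defines "w \<equiv> real (card D2) * (real k * (real k - 1) / (real (card D) * (real (card D) - 1))) * t"
  defines "Z \<equiv> 3 * real k ^ 4 / real n ^ 2"
  defines "y0 \<equiv> real n ^ (2 * k) * fact (n - 2 * k) / fact n"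
  defines "y1 \<equiv> real n ^ (2 * k - 1) * fact (n + 1 - 2 * k) / fact n"
  assumes k: "2 * k \<le> n"
  obtains c0 c1 r where
    "real (M k) * fact k / (2 ^ k * fact n)
       = c0\<^sup>2 * y0 + (if 2 \<le> k then c1\<^sup>2 * real n / (2 * (real k * (real k - 1))) * y1 else 0) + r"
    "\<bar>c0 - (t - w)\<bar> \<le> Z" "w - Z \<le> c1" "c1 \<le> w" "0 \<le> c1" "0 \<le> r" "r \<le> Z * y0"
proof -
  have n0: "0 < n" using card_A by (simp add: n_def)
  have kn: "k < n" using k n0 by (cases k) auto
  define R where "R = {S \<in> Sub k. 2 \<le> card (adj S)}"
  define \<nu> where "\<nu> = fact k / real n ^ k"
  have \<nu>: "0 \<le> \<nu>" by (simp add: \<nu>_def)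
  define c0 where "c0 = real (card (F k 0)) * \<nu>"
  define c1 where "c1 = real (card (F k 1)) * \<nu>"
  define cR where "cR = real (card R) * \<nu>"
  have finR: "finite R" using finite_Sub by (simp add: R_def)
  have split: "(\<Sum>S\<in>Sub k. f S) = (\<Sum>S\<in>F k 0. f S) + (\<Sum>S\<in>F k 1. f S) + (\<Sum>S\<in>R. f S)"
    for f :: "'a set \<Rightarrow> real"
  proof -
    have "Sub k = F k 0 \<union> F k 1 \<union> R" by (auto simp: Sub_def F_def R_def)
    moreover have "F k 0 \<inter> F k 1 = {}" "(F k 0 \<union> F k 1) \<inter> R = {}" by (auto simp: F_def R_def)
    ultimately show ?thesis using finite_F finR by (simp add: sum.union_disjoint)
  qed
  let ?W = "\<lambda>S. real (card (adj S))"
  have sumW: "(\<Sum>S\<in>Sub k. ?W S) * \<nu> = w"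
    unfolding sum_card_adj w_def t_def \<nu>_def by simp
  have sumZ: "(\<Sum>S\<in>Sub k. ?W S * (?W S - 1)) * \<nu> \<le> Z"
    using sum_card_adj_pairs[OF n_def[THEN meta_eq_to_obj_eq]] kn by (simp add: \<nu>_def Z_def)
  have total: "c0 + c1 + cR = t"
  proof -
    have "real (card (Sub k)) = (\<Sum>S\<in>Sub k. 1)" by simp
    also have "\<dots> = real (card (F k 0)) + real (card (F k 1)) + real (card R)" unfolding split by simp
    finally have "real (card (Sub k)) * \<nu> = c0 + c1 + cR" by (simp add: c0_def c1_def cR_def distrib_right)
    then show ?thesis using n_subsets[OF finite_D] by (simp add: Sub_def t_def \<nu>_def)
  qed
  have W1: "(\<Sum>S\<in>F k 1. ?W S) = real (card (F k 1))" and W0: "(\<Sum>S\<in>F k 0. ?W S) = 0"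
    by (simp_all add: F_def)
  have R2: "2 \<le> ?W S" if "S \<in> R" for S using that by (simp add: R_def)
  have sumR: "(\<Sum>S\<in>R. ?W S * (?W S - 1)) * \<nu> \<le> Z"
  proof -
    have "(\<Sum>S\<in>Sub k. ?W S * (?W S - 1)) = (\<Sum>S\<in>R. ?W S * (?W S - 1))"
      unfolding split by (simp add: F_def)
    then show ?thesis using sumZ by simp
  qed
  \<comment> \<open>On \<open>R\<close> the number of pairs \<open>W\<close> is at least 2, so
    \<open>W * (W - 1)\<close> dominates both 1 and \<open>W\<close>. The second factorial moment
    thus bounds the weight of \<open>R\<close> and also its share of the first moment.\<close>
  have cR: "cR \<le> Z"
  proof -
    have "real (card R) = (\<Sum>S\<in>R. 1)" by simp
    also have "\<dots> \<le> (\<Sum>S\<in>R. ?W S * (?W S - 1))"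
    proof (rule sum_mono)
      fix S assume "S \<in> R"
      then show "1 \<le> ?W S * (?W S - 1)" using R2[of S] mult_mono[of 1 "?W S" 1 "?W S - 1"] by simp
    qed
    finally show ?thesis using mult_right_mono[OF _ \<nu>] sumR unfolding cR_def by (meson order_trans)
  qed
  \<comment> \<open>Together with \<open>total\<close> this makes \<open>c0 - (t - w)\<close> the
    share of \<open>R\<close> in the first moment minus \<open>cR\<close>, a number between 0 and
    \<open>Z\<close>.\<close>
  have "w = c1 + (\<Sum>S\<in>R. ?W S) * \<nu>"
    unfolding sumW[symmetric] split W0 W1 by (simp add: c1_def distrib_right)
  moreover have "(\<Sum>S\<in>R. ?W S) * \<nu> \<le> Z"
  proof -
    have "(\<Sum>S\<in>R. ?W S) \<le> (\<Sum>S\<in>R. ?W S * (?W S - 1))"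
    proof (rule sum_mono)
      fix S assume "S \<in> R"
      then show "?W S \<le> ?W S * (?W S - 1)" using R2[of S] mult_left_mono[of 1 "?W S - 1" "?W S"] by simp
    qed
    then show ?thesis using mult_right_mono[OF _ \<nu>] sumR by (meson order_trans)
  qed
  moreover have "cR \<le> (\<Sum>S\<in>R. ?W S) * \<nu>"
  proof -
    have "real (card R) = (\<Sum>S\<in>R. 1)" by simp
    also have "\<dots> \<le> (\<Sum>S\<in>R. ?W S)" using R2 by (intro sum_mono) fastforce
    finally show ?thesis unfolding cR_def by (rule mult_right_mono[OF _ \<nu>])
  qed
  moreover have "0 \<le> cR" using \<nu> by (simp add: cR_def)
  ultimately have bounds: "\<bar>c0 - (t - w)\<bar> \<le> Z" "w - Z \<le> c1" "c1 \<le> w"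
    using total by auto
  \<comment> \<open>The leading behaviour of \<open>M k\<close> is
    \<open>2 ^ k * fact n / fact k\<close>, as for a Poisson variable with mean 2.\<close>
  define \<mu> where "\<mu> = fact k / (2 ^ k * fact n :: real)"
  have \<mu>: "0 \<le> \<mu>" by (simp add: \<mu>_def)
  define r where "r = (\<Sum>S\<in>R. real (card (N S))) * \<mu>"
  have r0: "0 \<le> r" using \<mu> by (simp add: r_def sum_nonneg)
  have rZ: "r \<le> Z * y0"
  proof -
    have "real (card (N S)) * \<mu> \<le> \<nu> * y0" if "S \<in> R" for S
    proof -
      define W where "W = card (adj S)"
      have S: "S \<subseteq> D" "card S = k" using that by (auto simp: R_def Sub_def)
      then have W: "W \<le> k" using card_adj_le[OF S(1)] by (simp add: W_def)
      have "card (N S) \<le> 2 ^ k * n ^ (k - W) * fact (n - (2 * k - W))"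
        using card_N_le[OF S(1)] S(2) kn by (simp add: n_def W_def)
      then have "real (card (N S)) \<le> real (2 ^ k * n ^ (k - W) * fact (n - (2 * k - W)))"
        by (rule of_nat_mono)
      then have "real (card (N S)) * \<mu> \<le> (2 ^ k * real n ^ (k - W) * fact (n - (2 * k - W))) * \<mu>"
        using \<mu> by (intro mult_right_mono) simp_all
      also have "\<dots> = \<nu> * (real n ^ (2 * k - W) * fact (n - (2 * k - W)) / fact n)"
      proof -
        have "2 * k - W = k + (k - W)" using W by simp
        then have "real n ^ (2 * k - W) = real n ^ k * real n ^ (k - W)" by (simp only: power_add)
        then show ?thesis using n0 by (simp add: \<mu>_def \<nu>_def field_simps)
      qed
      also have "\<dots> \<le> \<nu> * y0"
        unfolding y0_def using \<nu> power_fact_mono[of "2 * k - W" "2 * k" n] k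
        by (intro mult_left_mono divide_right_mono) auto
      finally show ?thesis .
    qed
    then have "r \<le> (\<Sum>S\<in>R. \<nu> * y0)" unfolding r_def sum_distrib_right by (rule sum_mono)
    also have "\<dots> = cR * y0" by (simp add: cR_def)
    also have "\<dots> \<le> Z * y0" using cR by (intro mult_right_mono) (simp_all add: y0_def)
    finally show ?thesis .
  qed
  have M: "real (M k) * \<mu> = (\<Sum>S\<in>F k 0. real (card (N S))) * \<mu> + (\<Sum>S\<in>F k 1. real (card (N S))) * \<mu> + r"
    unfolding M_def of_nat_sum split r_def by (simp add: distrib_right)
  have M0: "(\<Sum>S\<in>F k 0. real (card (N S))) * \<mu> = c0\<^sup>2 * y0"
  proof -
    have "(\<Sum>S\<in>F k 0. real (card (N S))) = real (card (F k 0)) * (real (card (F k 0)) * (fact k * 2 ^ k * fact (n - 2 * k)))"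
      by (simp add: card_N_0 n_def)
    moreover have "real n ^ (2 * k) = real n ^ k * real n ^ k" by (simp add: mult_2 power_add)
    ultimately show ?thesis
      using n0 by (simp add: c0_def \<nu>_def \<mu>_def y0_def power2_eq_square field_simps)
  qed
  have M1: "(\<Sum>S\<in>F k 1. real (card (N S))) * \<mu>
      = (if 2 \<le> k then c1\<^sup>2 * real n / (2 * (real k * (real k - 1))) * y1 else 0)"
  proof (cases "2 \<le> k")
    case True
    then obtain j where j: "k = Suc (Suc j)" by (metis add_2_eq_Suc le_Suc_ex)
    have sum: "(\<Sum>S\<in>F k 1. real (card (N S)))
        = real (card (F k 1)) * (real (card (F k 1)) * (fact j * 2 ^ Suc j * fact (n + 1 - 2 * k)))"
      using True by (simp add: card_N_1 n_def j)
    have "real n ^ (2 * k - 1) * real n = real n ^ k * real n ^ k"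
      using j by (simp add: mult_2 flip: power_add power_Suc2)
    then have y1: "y1 = real n ^ k * real n ^ k / real n * fact (n + 1 - 2 * k) / fact n"
      using n0 by (simp add: y1_def eq_divide_eq)
    have fk: "fact k = real k * (real k - 1) * fact j" and pk: "(2::real) ^ k = 2 * 2 ^ Suc j"
      by (simp_all add: j algebra_simps)
    \<comment> \<open>To be read with \<open>c\<close> the number of edge sets with one pair,
      \<open>a = fact j\<close>, \<open>P = 2 ^ Suc j\<close>, \<open>q = k * (k - 1)\<close>,
      \<open>L = n ^ k\<close> and \<open>l = n\<close>; \<open>f\<close> and \<open>g\<close> are
      the two factorials in \<open>y1\<close>.\<close>
    have alg: "c * (c * (a * P * f)) * (q * a / (2 * P * g)) = (c * (q * a / L))\<^sup>2 * l / (2 * q) * (L * L / l * f / g)"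
      if "q \<noteq> 0" "P \<noteq> 0" "L \<noteq> 0" "l \<noteq> 0" "g \<noteq> 0" for a c f g l L P q :: real
      using that by (simp add: field_simps power2_eq_square)
    have "(\<Sum>S\<in>F k 1. real (card (N S))) * \<mu> = c1\<^sup>2 * real n / (2 * (real k * (real k - 1))) * y1"
      unfolding sum y1 c1_def \<nu>_def \<mu>_def fk pk
      by (rule alg) (use n0 True in auto)
    then show ?thesis using True by simp
  next
    case False
    have "F k 1 = {}"
    proof (rule ccontr)
      assume "F k 1 \<noteq> {}"
      then obtain S x where S: "S \<subseteq> D" "adj S = {x}" "card S = k" by (auto simp: F_def card_1_singleton_iff)
      have "{x, s x} \<subseteq> S" "card {x, s x} = 2" using adj_single[OF S(1,2)] by auto
      then show False using False S(3) card_mono[OF finite_sub[OF S(1)], of "{x, s x}"] by simp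
    qed
    then show ?thesis using False by simp
  qed
  show thesis
  proof (rule that)
    show "real (M k) * fact k / (2 ^ k * fact n)
       = c0\<^sup>2 * y0 + (if 2 \<le> k then c1\<^sup>2 * real n / (2 * (real k * (real k - 1))) * y1 else 0) + r"
      using M unfolding M0 M1 by (simp add: \<mu>_def)
    show "0 \<le> c1" using \<nu> by (simp add: c1_def)
  qed (use bounds r0 rZ in auto)
qed

end

section \<open>First-order expansions with explicit error constants\<close>

lemma prod_one_minus_bounds:
  fixes f :: "nat \<Rightarrow> real"
  assumes "\<And>i. i < k \<Longrightarrow> f i \<in> {0..1}"
  shows "1 - (\<Sum>i<k. f i) \<le> (\<Prod>i<k. 1 - f i)"
    and "(\<Prod>i<k. 1 - f i) \<le> 1 - (\<Sum>i<k. f i) + (\<Sum>i<k. f i)\<^sup>2"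
proof -
  show "1 - (\<Sum>i<k. f i) \<le> (\<Prod>i<k. 1 - f i)"
    using assms by (intro Weierstrass_prod_ineq) auto
  show "(\<Prod>i<k. 1 - f i) \<le> 1 - (\<Sum>i<k. f i) + (\<Sum>i<k. f i)\<^sup>2"
    using assms
  proof (induction k)
    case (Suc k)
    define a where "a = f k"
    define \<sigma> where "\<sigma> = (\<Sum>i<k. f i)"
    have a: "0 \<le> a" "a \<le> 1" using Suc.prems[of k] by (auto simp: a_def)
    have \<sigma>: "0 \<le> \<sigma>" unfolding \<sigma>_def using Suc.prems by (intro sum_nonneg) (auto simp: less_Suc_eq)
    have "(\<Prod>i<Suc k. 1 - f i) \<le> (1 - \<sigma> + \<sigma>\<^sup>2) * (1 - a)"
      using Suc.IH Suc.prems a by (simp add: a_def \<sigma>_def mult_right_mono)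
    also have "\<dots> = 1 - (\<sigma> + a) + (\<sigma> + a)\<^sup>2 - (a\<^sup>2 + \<sigma> * a + \<sigma>\<^sup>2 * a)"
      by (simp add: algebra_simps power2_eq_square)
    also have "\<dots> \<le> 1 - (\<sigma> + a) + (\<sigma> + a)\<^sup>2"
      using a \<sigma> mult_nonneg_nonneg[OF \<sigma> a(1)] mult_nonneg_nonneg[OF zero_le_power2[of \<sigma>] a(1)]
        zero_le_power2[of a] by linarith
    finally show ?case by (simp add: a_def \<sigma>_def)
  qed simp
qed

lemma choose_fact_eq_prod:
  assumes "d \<le> n" "0 < n"
  shows "real ((n - d) choose k) * fact k / real n ^ k = (\<Prod>i<k. 1 - real (d + i) / real n)"
proof -
  have "fact k * real ((n - d) choose k) = (\<Prod>i<k. real (n - d) - real i)"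
    by (simp add: binomial_gbinomial gbinomial_mult_fact atLeast0LessThan)
  then have "real ((n - d) choose k) * fact k / real n ^ k = (\<Prod>i<k. (real (n - d) - real i) / real n)"
    by (simp add: prod_dividef mult.commute)
  also have "\<dots> = (\<Prod>i<k. 1 - real (d + i) / real n)"
    using assms by (intro prod.cong refl) (simp add: of_nat_diff field_simps)
  finally show ?thesis .
qed

lemma fact_quotient_eq_prod:
  assumes "v \<le> n" "0 < n"
  shows "real n ^ v * fact (n - v) / fact n = inverse (\<Prod>i<v. 1 - real i / real n)"
proof -
  have "real n ^ v * fact (n - v) / fact n = inverse (real (n choose v) * fact v / real n ^ v)"
    using binomial_fact[OF assms(1), where 'a = real] by (simp add: mult.commute)
  moreover have "real (n choose v) * fact v / real n ^ v = (\<Prod>i<v. 1 - real i / real n)"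
    using choose_fact_eq_prod[of 0 n v] assms by simp
  ultimately show ?thesis by (simp only:)
qed

lemma sum_lessThan_real: "(\<Sum>i<k. real (d + i)) = real d * real k + real k * (real k - 1) / 2"
  by (induction k) (simp_all add: field_simps)

text \<open>Multiplies two expansions of the form one plus a first-order term plus an error of order
  \<open>\<epsilon>\<^sup>2\<close>. The constants are explicit because the result must be uniform
  in \<open>k\<close>.\<close>

lemma approx_mult:
  fixes x y u v \<epsilon> A B a b :: real
  assumes x: "\<bar>x - 1 - u\<bar> \<le> A * \<epsilon>\<^sup>2" "\<bar>u\<bar> \<le> a * \<epsilon>" and y: "\<bar>y - 1 - v\<bar> \<le> B * \<epsilon>\<^sup>2" "\<bar>v\<bar> \<le> b * \<epsilon>"
    and \<epsilon>: "0 \<le> \<epsilon>" "\<epsilon> \<le> 1" and "0 \<le> A" "0 \<le> B" "0 \<le> a" "0 \<le> b"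
  shows "\<bar>x * y - 1 - (u + v)\<bar> \<le> (A * (1 + b + B) + (1 + a) * B + a * b) * \<epsilon>\<^sup>2"
proof -
  have e2: "\<epsilon>\<^sup>2 \<le> 1" using \<epsilon> by (simp add: power_le_one)
  have "\<bar>y\<bar> \<le> \<bar>y - 1 - v\<bar> + 1 + \<bar>v\<bar>" by linarith
  also have "\<dots> \<le> B + 1 + b"
  proof -
    have "B * \<epsilon>\<^sup>2 \<le> B" "b * \<epsilon> \<le> b" using assms e2 mult_left_le by auto
    then show ?thesis using y by linarith
  qed
  finally have Y: "\<bar>y\<bar> \<le> 1 + b + B" by simp
  have U: "\<bar>1 + u\<bar> \<le> 1 + a"
  proof -
    have "a * \<epsilon> \<le> a" using assms mult_left_le by auto
    then show ?thesis using x by linarith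
  qed
  have "x * y - 1 - (u + v) = (x - 1 - u) * y + (1 + u) * (y - 1 - v) + u * v"
    by (simp add: algebra_simps)
  also have "\<bar>\<dots>\<bar> \<le> \<bar>x - 1 - u\<bar> * \<bar>y\<bar> + \<bar>1 + u\<bar> * \<bar>y - 1 - v\<bar> + \<bar>u\<bar> * \<bar>v\<bar>"
    unfolding abs_mult[symmetric] by linarith
  also have "\<dots> \<le> (A * \<epsilon>\<^sup>2) * (1 + b + B) + (1 + a) * (B * \<epsilon>\<^sup>2) + (a * \<epsilon>) * (b * \<epsilon>)"
    using assms x y Y U by (intro add_mono mult_mono) auto
  finally show ?thesis by (simp add: algebra_simps power2_eq_square)
qed

text \<open>The hypotheses on \<open>p\<close> are those delivered by
  \<open>prod_one_minus_bounds\<close>. The claim follows by multiplying \<open>p\<close> with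
  \<open>1 + z + 2 * z\<^sup>2\<close> and with \<open>1 + z - 2 * z\<^sup>2\<close>.\<close>

lemma inverse_approx:
  fixes p z :: real
  assumes "1 - z \<le> p" "p \<le> 1 - z + z\<^sup>2" "0 \<le> z" "z \<le> 1 / 2"
  shows "\<bar>inverse p - 1 - z\<bar> \<le> 2 * z\<^sup>2" "1 \<le> inverse p" "inverse p \<le> 2"
proof -
  have z2: "z\<^sup>2 \<le> z / 2" using mult_left_mono[of z "1/2" z] assms by (simp add: power2_eq_square)
  have p: "1 / 2 \<le> p" "p \<le> 1" using assms z2 by linarith+
  show "1 \<le> inverse p" "inverse p \<le> 2" using p by (simp_all add: field_simps)
  have up: "1 \<le> p * (1 + z + 2 * z\<^sup>2)"
  proof -
    have "1 \<le> (1 - z) * (1 + z + 2 * z\<^sup>2)"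
    proof -
      have "(1 - z) * (1 + z + 2 * z\<^sup>2) = 1 + z\<^sup>2 * (1 - 2 * z)" by (simp add: algebra_simps power2_eq_square)
      then show ?thesis using assms by simp
    qed
    also have "\<dots> \<le> p * (1 + z + 2 * z\<^sup>2)" using assms by (intro mult_right_mono) auto
    finally show ?thesis .
  qed
  have lo: "p * (1 + z - 2 * z\<^sup>2) \<le> 1"
  proof -
    have nn: "0 \<le> 1 + z - 2 * z\<^sup>2" using z2 by linarith
    have "p * (1 + z - 2 * z\<^sup>2) \<le> (1 - z + z\<^sup>2) * (1 + z - 2 * z\<^sup>2)"
      using assms nn by (intro mult_right_mono) auto
    also have "\<dots> = 1 - z\<^sup>2 * (2 - 3 * z + 2 * z\<^sup>2)" by (simp add: algebra_simps power2_eq_square)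
    also have "\<dots> \<le> 1"
    proof -
      have "0 \<le> 2 - 3 * z + 2 * z\<^sup>2" using assms zero_le_power2[of z] by linarith
      then show ?thesis by simp
    qed
    finally show ?thesis .
  qed
  have "inverse p \<le> 1 + z + 2 * z\<^sup>2" "1 + z - 2 * z\<^sup>2 \<le> inverse p"
    using up lo p by (simp_all add: field_simps)
  then show "\<bar>inverse p - 1 - z\<bar> \<le> 2 * z\<^sup>2" by linarith
qed

text \<open>To first order, \<open>c0\<close> is \<open>1 - u - v\<close>, \<open>c1\<close> is
  \<open>v\<close> and \<open>y0\<close> is \<open>1 + z\<close>. So the first term is
  \<open>1 - 2 * u - 2 * v + z\<close>, the second is \<open>v / 2\<close>, and \<open>r\<close> is
  negligible. The constant 1200 exceeds the sum 1093 + 29 + 6 of the three errors.\<close>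

lemma expansion_arith:
  fixes \<epsilon> t u v \<kappa> z c0 c1 y0 y1 r Z :: real
  assumes \<epsilon>: "0 \<le> \<epsilon>" "\<epsilon> \<le> 1 / 16"
    and t: "1 - u \<le> t" "t \<le> 1 - u + u\<^sup>2" and u: "0 \<le> u" "u \<le> \<epsilon>"
    and v: "0 \<le> v" "v \<le> \<epsilon>" and \<kappa>: "\<bar>\<kappa> - 1\<bar> \<le> 2 * \<epsilon>"
    and z: "0 \<le> z" "z \<le> 2 * \<epsilon>" and y0: "\<bar>y0 - 1 - z\<bar> \<le> 2 * z\<^sup>2" and y1: "1 \<le> y1" "y1 \<le> y0"
    and Z: "Z \<le> 3 * \<epsilon>\<^sup>2" "v \<noteq> 0 \<Longrightarrow> Z \<le> 6 * \<epsilon> * v"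
    and c0: "\<bar>c0 - (t - v * \<kappa> * t)\<bar> \<le> Z"
    and c1: "v * \<kappa> * t - Z \<le> c1" "c1 \<le> v * \<kappa> * t" "0 \<le> c1"
    and r: "0 \<le> r" "r \<le> Z * y0"
  shows "\<bar>c0\<^sup>2 * y0 + (if v = 0 then 0 else c1\<^sup>2 / (2 * v) * y1) + r - 1 - (- 2 * u - 3 / 2 * v + z)\<bar>
           \<le> 1200 * \<epsilon>\<^sup>2"
proof -
  have e1: "\<epsilon> \<le> 1" using \<epsilon> by simp
  have e2: "\<epsilon>\<^sup>2 \<le> \<epsilon> / 16" using mult_left_mono[OF \<epsilon>(2,1)] by (simp add: power2_eq_square)
  have u2: "u\<^sup>2 \<le> \<epsilon>\<^sup>2" "u\<^sup>2 \<le> u" 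
    using power_mono[OF u(2,1), of 2] mult_left_mono[of u 1 u] u e1 by (simp_all add: power2_eq_square)
  have t1: "t \<le> 1" "1 - \<epsilon> \<le> t" using t u u2 by linarith+
  have \<kappa>t: "\<bar>\<kappa> * t - 1\<bar> \<le> 3 * \<epsilon>"
  proof -
    have "\<bar>\<kappa> * t - 1\<bar> = \<bar>(\<kappa> - 1) * t + (t - 1)\<bar>" by (simp add: algebra_simps)
    also have "\<dots> \<le> \<bar>\<kappa> - 1\<bar> * \<bar>t\<bar> + \<bar>t - 1\<bar>" unfolding abs_mult[symmetric] by linarith
    also have "\<dots> \<le> (2 * \<epsilon>) * 1 + \<epsilon>" using \<kappa> t1 \<epsilon> by (intro add_mono mult_mono) auto
    finally show ?thesis by simp
  qed
  have w: "\<bar>v * \<kappa> * t - v\<bar> \<le> 3 * \<epsilon>\<^sup>2"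
  proof -
    have "\<bar>v * \<kappa> * t - v\<bar> = v * \<bar>\<kappa> * t - 1\<bar>" 
    proof -
      have "v * \<kappa> * t - v = v * (\<kappa> * t - 1)" by (simp add: algebra_simps)
      then show ?thesis using v(1) by (simp add: abs_mult)
    qed
    also have "\<dots> \<le> \<epsilon> * (3 * \<epsilon>)" using v \<kappa>t \<epsilon> by (intro mult_mono) auto
    finally show ?thesis by (simp add: power2_eq_square)
  qed
  have c0': "\<bar>c0 - 1 - (- u - v)\<bar> \<le> 7 * \<epsilon>\<^sup>2" using c0 w t u2 Z(1) by linarith
  have z2: "z\<^sup>2 \<le> 4 * \<epsilon>\<^sup>2" using power_mono[OF z(2,1), of 2] by (simp add: power_mult_distrib)
  have y0': "\<bar>y0 - 1 - z\<bar> \<le> 8 * \<epsilon>\<^sup>2" using y0 z2 by linarith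
  \<comment> \<open>\<open>approx_mult\<close> gives the error constant 95 for the square of
    \<open>c0\<close> and then 1093 for its product with \<open>y0\<close>.\<close>
  have "\<bar>c0 * c0 - 1 - ((- u - v) + (- u - v))\<bar> \<le> (7 * (1 + 2 + 7) + (1 + 2) * 7 + 2 * 2) * \<epsilon>\<^sup>2"
    using c0' u v e1 \<epsilon> by (intro approx_mult) auto
  then have "\<bar>c0 * c0 * y0 - 1 - (((- u - v) + (- u - v)) + z)\<bar> \<le> (95 * (1 + 2 + 8) + (1 + 4) * 8 + 4 * 2) * \<epsilon>\<^sup>2"
    using y0' u v z e1 \<epsilon> by (intro approx_mult) auto
  then have first: "\<bar>c0\<^sup>2 * y0 - 1 - (- 2 * u - 2 * v + z)\<bar> \<le> 1093 * \<epsilon>\<^sup>2"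
    by (simp add: power2_eq_square)
  have y03: "y0 \<le> 1 + 3 * \<epsilon>" using y0' z e2 by linarith
  have y02: "y0 \<le> 2" using y03 \<epsilon> by linarith
  have second: "\<bar>(if v = 0 then 0 else c1\<^sup>2 / (2 * v) * y1) - v / 2\<bar> \<le> 29 * \<epsilon>\<^sup>2"
  proof (cases "v = 0")
    case False
    then have v0: "0 < v" using v by simp
    \<comment> \<open>Since \<open>c1\<^sup>2\<close> is divided by \<open>v\<close>, an absolute
      error of order \<open>\<epsilon>\<^sup>2\<close> in \<open>c1\<close> does not suffice when
      \<open>v\<close> is small. The relative error is controlled by the second bound on
      \<open>Z\<close>.\<close>
    define \<rho> where "\<rho> = c1 / v"
    have c1\<rho>: "c1 = v * \<rho>" using v0 by (simp add: \<rho>_def)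
    have "v * \<rho> \<le> v * (\<kappa> * t)" using c1 c1\<rho> by (simp add: mult.assoc)
    then have hi: "\<rho> \<le> 1 + 3 * \<epsilon>" using \<kappa>t v0 by (simp add: abs_le_iff)
    have "v * (\<kappa> * t - 6 * \<epsilon>) \<le> v * \<rho>" using c1 Z(2)[OF False] c1\<rho> by (simp add: algebra_simps)
    then have lo: "1 - 9 * \<epsilon> \<le> \<rho>" using \<kappa>t v0 by (simp add: abs_le_iff)
    have \<rho>0: "0 \<le> \<rho>" using c1 v0 by (simp add: \<rho>_def)
    have "\<rho> \<le> 2" using hi \<epsilon> by linarith
    have sq: "\<bar>\<rho>\<^sup>2 - 1\<bar> \<le> 27 * \<epsilon>"
    proof -
      have "\<bar>\<rho>\<^sup>2 - 1\<bar> = \<bar>\<rho> - 1\<bar> * \<bar>\<rho> + 1\<bar>" by (simp add: abs_mult[symmetric] power2_eq_square algebra_simps)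
      also have "\<dots> \<le> (9 * \<epsilon>) * 3" using hi lo \<rho>0 \<open>\<rho> \<le> 2\<close> \<epsilon> by (intro mult_mono) auto
      finally show ?thesis by simp
    qed
    have "\<bar>\<rho>\<^sup>2 * y1 - 1\<bar> = \<bar>(\<rho>\<^sup>2 - 1) * y1 + (y1 - 1)\<bar>" by (simp add: algebra_simps)
    also have "\<dots> \<le> \<bar>\<rho>\<^sup>2 - 1\<bar> * \<bar>y1\<bar> + \<bar>y1 - 1\<bar>" unfolding abs_mult[symmetric] by linarith
    also have "\<dots> \<le> (27 * \<epsilon>) * 2 + 3 * \<epsilon>" using sq y1 y02 y03 \<epsilon> by (intro add_mono mult_mono) auto
    finally have rel: "\<bar>\<rho>\<^sup>2 * y1 - 1\<bar> \<le> 57 * \<epsilon>" by simp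
    have "(if v = 0 then 0 else c1\<^sup>2 / (2 * v) * y1) - v / 2 = v / 2 * (\<rho>\<^sup>2 * y1 - 1)"
      using v0 by (simp add: c1\<rho> power2_eq_square field_simps)
    also have "\<bar>\<dots>\<bar> = v / 2 * \<bar>\<rho>\<^sup>2 * y1 - 1\<bar>" using v0 by (simp add: abs_mult)
    also have "\<dots> \<le> \<epsilon> / 2 * (57 * \<epsilon>)" using rel v \<epsilon> by (intro mult_mono) auto
    also have "\<dots> \<le> 29 * \<epsilon>\<^sup>2" by (simp add: power2_eq_square)
    finally show ?thesis .
  qed (use \<epsilon> in simp)
  have third: "r \<le> 6 * \<epsilon>\<^sup>2"
  proof -
    have "Z * y0 \<le> (3 * \<epsilon>\<^sup>2) * y0" using Z(1) y1 by (intro mult_right_mono) auto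
    also have "\<dots> \<le> (3 * \<epsilon>\<^sup>2) * 2" using y02 by (intro mult_left_mono) auto
    finally show ?thesis using r by simp
  qed
  have "0 \<le> \<epsilon>\<^sup>2" by simp
  then show ?thesis using first second third r(1) unfolding abs_le_iff by argo
qed

text \<open>The ratio, called \<open>\<kappa>\<close> elsewhere, compares the exact expected number
  of pairs with \<open>k (k - 1) / n\<close>. Numerator and denominator differ by
  \<open>n - (d\<^sup>2 + d)\<close>, while the denominator is at least
  \<open>n * n / 2\<close>.\<close>

lemma coeff_ratio_approx:
  fixes d n :: real
  assumes d: "0 \<le> d" and n: "16 * (d + 1)\<^sup>2 \<le> n"
  shows "\<bar>n * (n - 2 * d) / ((n - d) * (n - d - 1)) - 1\<bar> \<le> 2 / n"
proof -
  have sq: "d + 1 \<le> (d + 1)\<^sup>2" using d mult_left_mono[of 1 "d + 1" "d + 1"] by (simp add: power2_eq_square)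
  then have "16 * (d + 1) \<le> 16 * (d + 1)\<^sup>2" by simp
  also note n
  finally have n1: "16 * (d + 1) \<le> n" .
  then have n16: "16 \<le> n" using d by simp
  have "(d + 1)\<^sup>2 = d\<^sup>2 + 2 * d + 1" by (simp add: power2_eq_square algebra_simps)
  then have dd: "d\<^sup>2 + d \<le> n" using n d zero_le_power2[of d] by linarith
  define P where "P = (n - d) * (n - d - 1)"
  have P: "n * n / 2 \<le> P"
  proof -
    have "(15 / 16 * n) * (15 / 16 * n) \<le> P"
      unfolding P_def using n1 d by (intro mult_mono) auto
    moreover have "n * n / 2 \<le> (15 / 16 * n) * (15 / 16 * n)" by simp
    ultimately show ?thesis by linarith
  qed
  have P0: "0 < P" using P n16 mult_pos_pos[of n n] by linarith
  have eq: "n * (n - 2 * d) = P + (n - (d\<^sup>2 + d))" by (simp add: P_def algebra_simps power2_eq_square)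
  have "\<bar>n * (n - 2 * d) / P - 1\<bar> = \<bar>n - (d\<^sup>2 + d)\<bar> / P"
    unfolding eq using P0 by (simp add: add_divide_distrib)
  also have "\<dots> \<le> n / (n * n / 2)"
    using P n16 dd d zero_le_power2[of d] by (intro frac_le) (simp, linarith, simp, linarith)
  also have "\<dots> = 2 / n" using n16 by simp
  finally show ?thesis by (simp add: P_def)
qed

text \<open>\<open>\<epsilon>\<close> is one scale that dominates \<open>u\<close>,
  \<open>v\<close>, half of \<open>z\<close>, half of the error of \<open>\<kappa>\<close>, and
  \<open>k * k / n\<close>. The summands 1 in its definition keep it at least \<open>1 / n\<close>
  when \<open>d\<close> or \<open>k\<close> is 0.\<close>

lemma (in successor) M_expansion:
  fixes d k :: nat
  defines "n \<equiv> real (card A)"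
  defines "\<epsilon> \<equiv> ((real d + 1) * (real k + 1))\<^sup>2 / n"
  assumes cD: "card D + d = card A" and cD2: "card D2 + 2 * d = card A" and \<epsilon>: "\<epsilon> \<le> 1 / 16"
  shows "\<bar>real (M k) * fact k / (2 ^ k * fact (card A)) - 1
            - (real k - 2 * real d * real k - real k * (real k - 1) / 2) / n\<bar> \<le> 1200 * \<epsilon>\<^sup>2"
proof -
  have n0: "0 < n" "0 < card A" using card_A by (simp_all add: n_def)
  have big: "16 * ((real d + 1) * (real k + 1))\<^sup>2 \<le> n" using \<epsilon> n0 by (simp add: \<epsilon>_def field_simps)
  have dk: "(real d + 1)\<^sup>2 \<le> ((real d + 1) * (real k + 1))\<^sup>2" "(real k + 1)\<^sup>2 \<le> ((real d + 1) * (real k + 1))\<^sup>2"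
    by (intro power_mono; simp add: mult_le_cancel_left1 mult_le_cancel_right1)+
  have kk: "(real k + 1)\<^sup>2 / n \<le> \<epsilon>" "(real d + 1)\<^sup>2 / n \<le> \<epsilon>"
    unfolding \<epsilon>_def using dk n0 by (simp_all add: divide_right_mono)
  have \<epsilon>0: "0 \<le> \<epsilon>" using n0 by (simp add: \<epsilon>_def)
  have k2: "real k * real k \<le> (real k + 1)\<^sup>2" "2 * real k \<le> (real k + 1)\<^sup>2" by (simp_all add: power2_eq_square algebra_simps)
  have "2 * real k \<le> n" using k2(2) dk(2) big zero_le_power2[of "(real d + 1) * (real k + 1)"] by linarith
  then have kn: "2 * k \<le> card A" by (simp add: n_def)
  define t where "t = real (card D choose k) * fact k / n ^ k"
  define u where "u = (real d * real k + real k * (real k - 1) / 2) / n"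
  define v where "v = real k * (real k - 1) / n"
  define \<kappa> where "\<kappa> = n * (n - 2 * real d) / ((n - real d) * (n - real d - 1))"
  define z where "z = (2 * real k * real k - real k) / n"
  define y0 where "y0 = n ^ (2 * k) * fact (card A - 2 * k) / fact (card A)"
  define y1 where "y1 = n ^ (2 * k - 1) * fact (card A + 1 - 2 * k) / fact (card A)"
  \<comment> \<open>For \<open>k = 0\<close> the exponent \<open>2 * k - 1\<close> is cut off at 0
    and \<open>y1\<close> equals \<open>n + 1\<close>, which violates \<open>y1 \<le> y0\<close>.
    Its coefficient vanishes there, so 1 may take its place.\<close>
  define y1' where "y1' = (if k = 0 then 1 else y1)"
  define Z where "Z = 3 * real k ^ 4 / n ^ 2"
  have cDr: "real (card D) = n - real d" "real (card D2) = n - 2 * real d"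
    using cD cD2 by (simp_all add: n_def algebra_simps flip: of_nat_add of_nat_mult)
  have w: "real (card D2) * (real k * (real k - 1) / (real (card D) * (real (card D) - 1))) * t = v * \<kappa> * t"
    unfolding cDr v_def \<kappa>_def using n0 by simp
  obtain c0 c1 r where c:
    "real (M k) * fact k / (2 ^ k * fact (card A))
       = c0\<^sup>2 * y0 + (if 2 \<le> k then c1\<^sup>2 * n / (2 * (real k * (real k - 1))) * y1 else 0) + r"
    "\<bar>c0 - (t - v * \<kappa> * t)\<bar> \<le> Z" "v * \<kappa> * t - Z \<le> c1" "c1 \<le> v * \<kappa> * t" "0 \<le> c1" "0 \<le> r" "r \<le> Z * y0"
    using M_decomposition[OF kn, folded n_def, folded t_def, unfolded w, folded Z_def y0_def y1_def] by metis
  have "v = 0 \<longleftrightarrow> \<not> 2 \<le> k" using n0 by (auto simp: v_def)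
  then have second: "(if 2 \<le> k then c1\<^sup>2 * n / (2 * (real k * (real k - 1))) * y1 else 0)
      = (if v = 0 then 0 else c1\<^sup>2 / (2 * v) * y1')"
    using n0 by (auto simp: v_def y1'_def)
  have t_eq: "t = (\<Prod>i<k. 1 - real (d + i) / n)"
  proof -
    have "card A - d = card D" "d \<le> card A" using cD by simp_all
    then show ?thesis using choose_fact_eq_prod[of d "card A" k] n0(2) unfolding t_def n_def by simp
  qed
  have u_eq: "(\<Sum>i<k. real (d + i) / n) = u"
    unfolding u_def sum_lessThan_real[symmetric] sum_divide_distrib ..
  have z_eq: "(\<Sum>i<2 * k. real i / n) = z"
    using sum_lessThan_real[of 0 "2 * k"] by (simp add: z_def algebra_simps flip: sum_divide_distrib)
  have in01: "real (d + i) / n \<in> {0..1}" if "i < k" for i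
  proof -
    have "(real d + 1) * (real k + 1) = real d * real k + real d + real k + 1"
      by (simp add: algebra_simps)
    moreover have "0 \<le> real d * real k" "real i \<le> real k" using that by simp_all
    ultimately have "real (d + i) \<le> (real d + 1) * (real k + 1)" unfolding of_nat_add by linarith
    also have "\<dots> \<le> ((real d + 1) * (real k + 1))\<^sup>2"
      by (rule self_le_power) (simp_all add: algebra_simps)
    also have "\<dots> \<le> n" using big zero_le_power2[of "(real d + 1) * (real k + 1)"] by linarith
    finally show ?thesis using n0 by simp
  qed
  have in01': "real i / n \<in> {0..1}" if "i < 2 * k" for i
    using that kn n0 by (simp add: n_def)
  note T = prod_one_minus_bounds[of k "\<lambda>i. real (d + i) / n", OF in01, unfolded u_eq, folded t_eq]
  note Y = prod_one_minus_bounds[of "2 * k" "\<lambda>i. real i / n", OF in01', unfolded z_eq]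
  have y0_eq: "y0 = inverse (\<Prod>i<2 * k. 1 - real i / n)"
    using fact_quotient_eq_prod[OF kn n0(2)] by (simp add: y0_def n_def)
  have u0: "0 \<le> u" using n0 in01 unfolding u_eq[symmetric] by (intro sum_nonneg) auto
  have z0: "0 \<le> z" using n0 unfolding z_eq[symmetric] by (intro sum_nonneg) auto
  have u\<epsilon>: "u \<le> \<epsilon>"
  proof -
    have "real d * real k + real k * (real k - 1) / 2 \<le> ((real d + 1) * (real k + 1))\<^sup>2"
    proof -
      have "real d * real k + real k * (real k - 1) / 2 \<le> (real d + 1) * (real k + 1) * (real k + 1)"
        by (simp add: algebra_simps)
      also have "\<dots> \<le> (real d + 1) * (real k + 1) * ((real d + 1) * (real k + 1))"
        by (intro mult_left_mono) (simp_all add: algebra_simps)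
      finally show ?thesis by (simp add: power2_eq_square)
    qed
    then show ?thesis unfolding u_def \<epsilon>_def using n0 by (simp add: divide_right_mono)
  qed
  have v0: "0 \<le> v" unfolding v_def using n0 by (cases k) auto
  have v\<epsilon>: "v \<le> \<epsilon>"
  proof -
    have "v \<le> (real k + 1)\<^sup>2 / n"
      unfolding v_def using n0 by (intro divide_right_mono) (auto simp: power2_eq_square algebra_simps)
    then show ?thesis using kk by linarith
  qed
  have z\<epsilon>: "z \<le> 2 * \<epsilon>"
  proof -
    have "z \<le> 2 * (real k + 1)\<^sup>2 / n"
      unfolding z_def using n0 by (intro divide_right_mono) (auto simp: power2_eq_square algebra_simps)
    then show ?thesis using kk by linarith
  qed
  have \<kappa>: "\<bar>\<kappa> - 1\<bar> \<le> 2 * \<epsilon>"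
  proof -
    have "16 * (real d + 1)\<^sup>2 \<le> n" using big dk by linarith
    then have "\<bar>\<kappa> - 1\<bar> \<le> 2 / n" unfolding \<kappa>_def by (intro coeff_ratio_approx) auto
    also have "\<dots> \<le> 2 * ((real d + 1)\<^sup>2 / n)" using n0 by (simp add: divide_right_mono one_le_power)
    finally show ?thesis using kk by linarith
  qed
  have y0: "\<bar>y0 - 1 - z\<bar> \<le> 2 * z\<^sup>2" "1 \<le> y0"
    unfolding y0_eq using inverse_approx[OF Y z0] z\<epsilon> \<epsilon> by auto
  have y1': "1 \<le> y1'" "y1' \<le> y0"
  proof -
    have "1 \<le> y1 \<and> y1 \<le> y0" if "k \<noteq> 0"
    proof -
      have e: "card A + 1 - 2 * k = card A - (2 * k - 1)" using that by simp
      show ?thesis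
        unfolding y1_def y0_def e n_def
        using power_fact_mono[of 0 "2 * k - 1" "card A"] power_fact_mono[of "2 * k - 1" "2 * k" "card A"] kn
        by (simp add: divide_right_mono)
    qed
    then show "1 \<le> y1'" "y1' \<le> y0" using y0(2) by (simp_all add: y1'_def)
  qed
  have ke: "real k * real k / n \<le> \<epsilon>"
  proof -
    have "real k * real k / n \<le> (real k + 1)\<^sup>2 / n" using k2 n0 by (intro divide_right_mono) auto
    then show ?thesis using kk by linarith
  qed
  have Z1: "Z \<le> 3 * \<epsilon>\<^sup>2"
  proof -
    have "(real k * real k / n)\<^sup>2 \<le> \<epsilon>\<^sup>2" using ke n0 by (intro power_mono) auto
    then show ?thesis by (simp add: Z_def power_divide eval_nat_numeral mult.assoc)
  qed
  \<comment> \<open>A nonzero \<open>v\<close> forces \<open>k \<ge> 2\<close>, and then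
    \<open>k * k\<close> is at most twice \<open>k * (k - 1)\<close>.\<close>
  have Z2: "Z \<le> 6 * \<epsilon> * v" if "v \<noteq> 0"
  proof -
    have k: "2 \<le> k" using that \<open>v = 0 \<longleftrightarrow> \<not> 2 \<le> k\<close> by blast
    have "Z = 3 * (real k * real k / n) * (real k * real k / n)"
      by (simp add: Z_def eval_nat_numeral mult.assoc)
    also have "\<dots> \<le> 3 * \<epsilon> * (2 * v)"
    proof (intro mult_mono)
      show "real k * real k / n \<le> 2 * v"
        unfolding v_def using k n0 by (simp add: divide_right_mono field_simps)
    qed (use ke \<epsilon>0 n0 in auto)
    finally show ?thesis by simp
  qed
  have "\<bar>c0\<^sup>2 * y0 + (if v = 0 then 0 else c1\<^sup>2 / (2 * v) * y1') + r - 1 - (- 2 * u - 3 / 2 * v + z)\<bar>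
           \<le> 1200 * \<epsilon>\<^sup>2"
    by (rule expansion_arith[OF \<epsilon>0 \<epsilon> T u0 u\<epsilon> v0 v\<epsilon> \<kappa> z0 z\<epsilon> y0(1) y1' Z1 Z2 c(2-7)])
  \<comment> \<open>The coefficients of \<open>k * k\<close> coming from \<open>u\<close>,
    \<open>v\<close> and \<open>z\<close> are -1, -3/2 and 2; they leave -1/2.\<close>
  moreover have "- 2 * u - 3 / 2 * v + z = (real k - 2 * real d * real k - real k * (real k - 1) / 2) / n"
    using n0 by (simp add: u_def v_def z_def field_simps)
  ultimately show ?thesis unfolding c(1) second by simp
qed

section \<open>Summation over k and choice of the truncation point\<close>

text \<open>The coefficient of \<open>1 / n\<close> in the normalised \<open>k\<close>-th binomial
  moment, as found in \<open>M_expansion\<close>.\<close>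

definition bad_coeff :: "real \<Rightarrow> nat \<Rightarrow> real" where
  "bad_coeff d k = real k - 2 * d * real k - real k * (real k - 1) / 2"

lemma sums_exp_linear: "(\<lambda>k. x ^ k / fact k * real k) sums (x * exp x)" for x :: real
proof -
  have "(\<lambda>k. x ^ k / fact k) sums exp x" using exp_converges[of x] by (simp add: field_simps scaleR_conv_of_real)
  then have "(\<lambda>k. x * (x ^ k / fact k)) sums (x * exp x)" by (rule sums_mult)
  moreover have "x * (x ^ k / fact k) = x ^ Suc k / fact (Suc k) * real (Suc k)" for k
    by (simp del: of_nat_Suc)
  ultimately have "(\<lambda>k. x ^ Suc k / fact (Suc k) * real (Suc k)) sums (x * exp x)" by simp
  then show ?thesis by (subst (asm) sums_Suc_iff) simp
qed

lemma sums_exp_quadratic: "(\<lambda>k. x ^ k / fact k * (real k * (real k - 1))) sums (x\<^sup>2 * exp x)" for x :: real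
proof -
  have "(\<lambda>k. x * (x ^ k / fact k * real k)) sums (x * (x * exp x))"
    by (intro sums_mult sums_exp_linear)
  moreover have "x * (x ^ k / fact k * real k) = x ^ Suc k / fact (Suc k) * (real (Suc k) * (real (Suc k) - 1))" for k
  proof -
    have "real (Suc k) - 1 = real k" by simp
    then show ?thesis by (simp del: of_nat_Suc)
  qed
  ultimately have "(\<lambda>k. x ^ Suc k / fact (Suc k) * (real (Suc k) * (real (Suc k) - 1))) sums (x * (x * exp x))" by simp
  then show ?thesis by (subst (asm) sums_Suc_iff) (simp add: power2_eq_square mult.assoc)
qed

text \<open>Against \<open>(- 2) ^ k / fact k\<close> the sequences 1, \<open>k\<close> and
  \<open>k (k - 1)\<close> sum to \<open>exp (- 2)\<close> times 1, -2 and 4. The coefficient of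
  \<open>1 / n\<close> is therefore
  \<open>(1 - 2 * d) * (- 2) - 4 / 2 = 4 * (d - 1)\<close>.\<close>

lemma main_series:
  "(\<lambda>k. (- 2) ^ k / fact k * (1 + bad_coeff d k / n)) sums (exp (- 2) * (1 + 4 * (d - 1) / n))" for d n :: real
proof -
  have "(\<lambda>k. (- 2) ^ k / fact k) sums exp (- 2 :: real)"
    using exp_converges[of "- 2 :: real"] by (simp add: field_simps scaleR_conv_of_real)
  then have "(\<lambda>k. (- 2) ^ k / fact k + (1 - 2 * d) / n * ((- 2) ^ k / fact k * real k)
          - 1 / (2 * n) * ((- 2) ^ k / fact k * (real k * (real k - 1))))
        sums (exp (- 2) + (1 - 2 * d) / n * ((- 2) * exp (- 2)) - 1 / (2 * n) * ((- 2)\<^sup>2 * exp (- 2)))"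
    by (intro sums_diff sums_add sums_mult sums_exp_linear sums_exp_quadratic)
  moreover have "exp (- 2) + (1 - 2 * d) / n * ((- 2) * exp (- 2)) - 1 / (2 * n) * ((- 2)\<^sup>2 * exp (- 2 :: real))
      = exp (- 2) * (1 + 4 * (d - 1) / n)"
    by (cases "n = 0") (simp_all add: field_simps)
  moreover have "(- 2) ^ k / fact k + (1 - 2 * d) / n * ((- 2) ^ k / fact k * real k)
          - 1 / (2 * n) * ((- 2) ^ k / fact k * (real k * (real k - 1)))
        = (- 2) ^ k / fact k * (1 + bad_coeff d k / n)" for k
    by (cases "n = 0") (simp_all add: bad_coeff_def field_simps)
  ultimately show ?thesis by simp
qed

text \<open>The exponent 6 serves two purposes: it covers the \<open>(k + 1) ^ 4\<close> in the
  squared error scale, and it leaves four spare powers over the growth \<open>(k + 1) ^ 2\<close> of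
  \<open>bad_coeff\<close>, which beyond \<open>K\<close> yield the factor
  \<open>(K + 1) ^ (-4)\<close>. Convergence follows from \<open>k + 1 \<le> exp k\<close>.\<close>

lemma summable_majorant: "summable (\<lambda>k. 2 ^ k * (real k + 1) ^ 6 / fact k :: real)"
proof (rule summable_comparison_test')
  show "summable (\<lambda>k. (2 * exp 6) ^ k / fact k :: real)"
    using summable_exp[of "2 * exp 6 :: real"] by (simp add: field_simps)
  fix k :: nat
  have "(real k + 1) ^ 6 \<le> exp (real k) ^ 6"
    using exp_ge_add_one_self[of "real k"] by (intro power_mono) (simp_all add: add.commute)
  also have "\<dots> = exp 6 ^ k" by (simp flip: exp_of_nat_mult add: mult.commute)
  finally show "norm (2 ^ k * (real k + 1) ^ 6 / fact k :: real) \<le> (2 * exp 6) ^ k / fact k"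
    by (simp add: power_mult_distrib divide_right_mono)
qed

lemma abs_bad_coeff_le:
  assumes "0 \<le> d"
  shows "\<bar>bad_coeff d k\<bar> \<le> 2 * (d + 1) * (real k + 1)\<^sup>2"
proof -
  have nn: "0 \<le> d * real k" "0 \<le> d * (real k * real k)" "0 \<le> real k * real k" using assms by simp_all
  have eq: "2 * (d + 1) * (real k + 1)\<^sup>2
      = 2 * (d * (real k * real k)) + 4 * (d * real k) + 2 * d + 2 * (real k * real k) + 4 * real k + 2"
    by (simp add: algebra_simps power2_eq_square)
  have "bad_coeff d k = real k - 2 * (d * real k) - (real k * real k) / 2 + real k / 2"
    by (simp add: bad_coeff_def field_simps)
  then show ?thesis unfolding eq abs_le_iff using nn assms by linarith
qed

text \<open>Three errors add up: replacing the moments below \<open>K\<close> by their expansions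
  (constant 1200), the tail of the limiting series (constant 3) and the Bonferroni remainder, which
  is the \<open>K\<close>-th moment itself (constant 8).\<close>

lemma (in successor) good_estimate:
  fixes d K :: nat
  defines "n \<equiv> real (card A)"
  defines "\<Gamma> \<equiv> (\<Sum>k. 2 ^ k * (real k + 1) ^ 6 / fact k :: real)"
  assumes cD: "card D + d = card A" and cD2: "card D2 + 2 * d = card A"
    and K: "0 < K" "16 * ((real d + 1) * (real K + 1))\<^sup>2 \<le> n"
  shows "\<bar>real (card {p. p permutes A \<and> bad p = {}}) / fact (card A) - exp (- 2) * (1 + 4 * (real d - 1) / n)\<bar>
     \<le> 1200 * (real d + 1) ^ 4 * \<Gamma> / n\<^sup>2 + 11 * (real d + 1) * \<Gamma> / (real K + 1) ^ 4"
proof -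
  let ?g = "\<lambda>k. 2 ^ k * (real k + 1) ^ 6 / fact k :: real"
  let ?f = "\<lambda>k. (- 2) ^ k / fact k * (1 + bad_coeff (real d) k / n)"
  let ?B = "\<lambda>k. real (M k) / fact (card A)"
  have n0: "1 \<le> n" using card_A by (simp add: n_def)
  have g0: "0 \<le> ?g k" for k by simp
  have \<Gamma>: "(\<Sum>k<m. ?g k) \<le> \<Gamma>" for m
    unfolding \<Gamma>_def using summable_majorant by (intro sum_le_suminf) auto
  have gK: "?g k \<le> \<Gamma>" for k
    using \<Gamma>[of "Suc k"] sum_nonneg[of "{..<k}" ?g] by simp
  have \<Gamma>0: "0 \<le> \<Gamma>" using gK[of 0] g0[of 0] by linarith
  define \<epsilon> where "\<epsilon> k = ((real d + 1) * (real k + 1))\<^sup>2 / n" for k :: nat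
  have \<epsilon>: "\<epsilon> k \<le> 1 / 16" if "k \<le> K" for k
  proof -
    have "((real d + 1) * (real k + 1))\<^sup>2 \<le> ((real d + 1) * (real K + 1))\<^sup>2"
      using that by (intro power_mono mult_left_mono) auto
    then have "16 * ((real d + 1) * (real k + 1))\<^sup>2 \<le> 16 * ((real d + 1) * (real K + 1))\<^sup>2" by simp
    also note K(2)
    finally show ?thesis using n0 by (simp add: \<epsilon>_def pos_divide_le_eq)
  qed
  have Bk: "\<bar>?B k - 2 ^ k / fact k * (1 + bad_coeff (real d) k / n)\<bar> \<le> 2 ^ k / fact k * (1200 * (\<epsilon> k)\<^sup>2)"
    if "k \<le> K" for k
  proof -
    have "?B k = 2 ^ k / fact k * (real (M k) * fact k / (2 ^ k * fact (card A)))" by simp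
    then have "?B k - 2 ^ k / fact k * (1 + bad_coeff (real d) k / n)
       = 2 ^ k / fact k * (real (M k) * fact k / (2 ^ k * fact (card A)) - 1 - bad_coeff (real d) k / n)"
      by (simp only: right_diff_distrib distrib_left)
    then have "\<bar>?B k - 2 ^ k / fact k * (1 + bad_coeff (real d) k / n)\<bar> = 2 ^ k / fact k * \<bar>real (M k) * fact k / (2 ^ k * fact (card A)) - 1 - bad_coeff (real d) k / n\<bar>"
      by (simp only: abs_mult) simp
    also have "\<dots> \<le> 2 ^ k / fact k * (1200 * (\<epsilon> k)\<^sup>2)"
      using M_expansion[OF cD cD2 \<epsilon>[OF that, unfolded \<epsilon>_def n_def]]
      by (intro mult_left_mono) (simp_all add: \<epsilon>_def n_def bad_coeff_def)
    finally show ?thesis .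
  qed
  have le6: "(real k + 1) ^ i \<le> (real k + 1) ^ 6" if "i \<le> 6" for i k
    using that by (intro power_increasing) auto
  have coeff: "\<bar>1 + bad_coeff (real d) k / n\<bar> \<le> 3 * (real d + 1) * (real k + 1)\<^sup>2" for k
  proof -
    have "\<bar>bad_coeff (real d) k / n\<bar> \<le> \<bar>bad_coeff (real d) k\<bar>"
      using n0 by (simp add: divide_le_eq mult_le_cancel_left1)
    moreover have "1 * 1 \<le> (real d + 1) * (real k + 1)\<^sup>2" by (intro mult_mono one_le_power) auto
    moreover define H where "H = (real d + 1) * (real k + 1)\<^sup>2"
    moreover have "\<bar>bad_coeff (real d) k\<bar> \<le> 2 * H"
      using abs_bad_coeff_le[OF of_nat_0_le_iff, of d k] by (simp only: H_def mult.assoc)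
    ultimately have "\<bar>1 + bad_coeff (real d) k / n\<bar> \<le> 3 * H" by linarith
    then show ?thesis by (simp only: H_def mult.assoc)
  qed
  have small: "2 ^ k / fact k * (real k + 1)\<^sup>2 \<le> ?g k / (real K + 1) ^ 4" if "K \<le> k" for k
  proof -
    have "(real K + 1) ^ 4 \<le> (real k + 1) ^ 4" using that by (intro power_mono) auto
    then have "(real k + 1)\<^sup>2 * (real K + 1) ^ 4 \<le> (real k + 1) ^ 6"
      using mult_left_mono[of "(real K + 1) ^ 4" "(real k + 1) ^ 4" "(real k + 1)\<^sup>2"] by (simp flip: power_add)
    then have "2 ^ k / fact k * ((real k + 1)\<^sup>2 * (real K + 1) ^ 4) \<le> 2 ^ k / fact k * (real k + 1) ^ 6"
      by (rule mult_left_mono) simp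
    then show ?thesis by (simp add: le_divide_eq mult.assoc)
  qed
  have fS: "?f sums (exp (- 2) * (1 + 4 * (real d - 1) / n))" by (rule main_series)
  have absf: "\<bar>?f k\<bar> \<le> 3 * (real d + 1) * ?g k / (real K + 1) ^ 4" if "K \<le> k" for k
  proof -
    have "\<bar>?f k\<bar> = 2 ^ k / fact k * \<bar>1 + bad_coeff (real d) k / n\<bar>" by (simp add: abs_mult power_abs)
    also have "\<dots> \<le> 2 ^ k / fact k * (3 * (real d + 1) * (real k + 1)\<^sup>2)"
      using coeff by (intro mult_left_mono) auto
    also have "\<dots> = 3 * (real d + 1) * (2 ^ k / fact k * (real k + 1)\<^sup>2)" by simp
    also have "\<dots> \<le> 3 * (real d + 1) * (?g k / (real K + 1) ^ 4)"
      by (intro mult_left_mono small that) auto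
    finally show ?thesis by simp
  qed
  have tail: "\<bar>exp (- 2) * (1 + 4 * (real d - 1) / n) - (\<Sum>k<K. ?f k)\<bar> \<le> 3 * (real d + 1) * \<Gamma> / (real K + 1) ^ 4"
  proof (rule LIMSEQ_le_const2)
    show "(\<lambda>m. \<bar>(\<Sum>k<m. ?f k) - (\<Sum>k<K. ?f k)\<bar>) \<longlonglongrightarrow> \<bar>exp (- 2) * (1 + 4 * (real d - 1) / n) - (\<Sum>k<K. ?f k)\<bar>"
      using fS unfolding sums_def by (intro tendsto_intros)
    have "\<bar>(\<Sum>k<m. ?f k) - (\<Sum>k<K. ?f k)\<bar> \<le> 3 * (real d + 1) * \<Gamma> / (real K + 1) ^ 4" if "K \<le> m" for m
    proof -
      have "(\<Sum>k<m. ?f k) - (\<Sum>k<K. ?f k) = (\<Sum>k=K..<m. ?f k)"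
        using sum_diff_nat_ivl[of 0 K m ?f] that by (simp add: atLeast0LessThan)
      also have "\<bar>\<dots>\<bar> \<le> (\<Sum>k=K..<m. \<bar>?f k\<bar>)" by (rule sum_abs)
      also have "\<dots> \<le> (\<Sum>k=K..<m. 3 * (real d + 1) * ?g k / (real K + 1) ^ 4)"
        using absf by (intro sum_mono) auto
      also have "\<dots> \<le> (\<Sum>k<m. 3 * (real d + 1) * ?g k / (real K + 1) ^ 4)"
        by (intro sum_mono2) auto
      also have "\<dots> = 3 * (real d + 1) * (\<Sum>k<m. ?g k) / (real K + 1) ^ 4"
        by (simp only: sum_distrib_left sum_divide_distrib)
      also have "\<dots> \<le> 3 * (real d + 1) * \<Gamma> / (real K + 1) ^ 4"
        using \<Gamma> by (intro divide_right_mono mult_left_mono) auto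
      finally show ?thesis .
    qed
    then show "\<exists>N. \<forall>m\<ge>N. \<bar>(\<Sum>k<m. ?f k) - (\<Sum>k<K. ?f k)\<bar> \<le> 3 * (real d + 1) * \<Gamma> / (real K + 1) ^ 4" by blast
  qed
  have middle: "\<bar>(\<Sum>k<K. (- 1) ^ k * ?B k) - (\<Sum>k<K. ?f k)\<bar> \<le> 1200 * (real d + 1) ^ 4 * \<Gamma> / n\<^sup>2"
  proof -
    have "\<bar>(\<Sum>k<K. (- 1) ^ k * ?B k) - (\<Sum>k<K. ?f k)\<bar>
        = \<bar>\<Sum>k<K. (- 1) ^ k * (?B k - 2 ^ k / fact k * (1 + bad_coeff (real d) k / n))\<bar>"
    proof -
      have "?f k = (- 1) ^ k * (2 ^ k / fact k * (1 + bad_coeff (real d) k / n))" for k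
        using power_mult_distrib[of "- 1 :: real" 2 k] by simp
      then show ?thesis by (simp only: right_diff_distrib sum_subtractf)
    qed
    also have "\<dots> \<le> (\<Sum>k<K. \<bar>(- 1) ^ k * (?B k - 2 ^ k / fact k * (1 + bad_coeff (real d) k / n))\<bar>)"
      by (rule sum_abs)
    also have "\<dots> \<le> (\<Sum>k<K. 1200 * (real d + 1) ^ 4 / n\<^sup>2 * ?g k)"
    proof (rule sum_mono)
      fix k assume k: "k \<in> {..<K}"
      have "\<bar>(- 1) ^ k * (?B k - 2 ^ k / fact k * (1 + bad_coeff (real d) k / n))\<bar>
          \<le> 2 ^ k / fact k * (1200 * (\<epsilon> k)\<^sup>2)"
      proof -
        have "\<bar>(- 1) ^ k * y\<bar> = \<bar>y\<bar>" for y :: real by (simp add: abs_mult)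
        then show ?thesis using Bk[of k] k by (simp only: lessThan_iff less_imp_le)
      qed
      also have "\<dots> = 1200 * (real d + 1) ^ 4 / n\<^sup>2 * (2 ^ k * (real k + 1) ^ 4 / fact k)"
      proof -
        have "(\<epsilon> k)\<^sup>2 = (real d + 1) ^ 4 * (real k + 1) ^ 4 / n\<^sup>2"
          by (simp add: \<epsilon>_def power_divide power_mult_distrib flip: power_mult)
        then show ?thesis by (simp add: mult_ac)
      qed
      also have "\<dots> \<le> 1200 * (real d + 1) ^ 4 / n\<^sup>2 * ?g k"
        by (intro mult_left_mono divide_right_mono le6) auto
      finally show "\<bar>(- 1) ^ k * (?B k - 2 ^ k / fact k * (1 + bad_coeff (real d) k / n))\<bar>
          \<le> 1200 * (real d + 1) ^ 4 / n\<^sup>2 * ?g k" .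
    qed
    also have "\<dots> = 1200 * (real d + 1) ^ 4 / n\<^sup>2 * (\<Sum>k<K. ?g k)" by (simp only: sum_distrib_left)
    also have "\<dots> \<le> 1200 * (real d + 1) ^ 4 / n\<^sup>2 * \<Gamma>" by (intro mult_left_mono \<Gamma>) auto
    finally show ?thesis by simp
  qed
  have last: "?B K \<le> 8 * (real d + 1) * \<Gamma> / (real K + 1) ^ 4"
  proof -
    have "(\<epsilon> K)\<^sup>2 \<le> (1 / 16)\<^sup>2" using \<epsilon>[of K] n0 by (intro power_mono) (auto simp: \<epsilon>_def)
    \<comment> \<open>At the truncation point only this crude bound is needed; 5 and the 3 of
      \<open>coeff\<close> make the factor 8 below.\<close>
    then have e: "1200 * (\<epsilon> K)\<^sup>2 \<le> 5" by (simp add: power2_eq_square)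
    have "?B K \<le> 2 ^ K / fact K * (1 + bad_coeff (real d) K / n) + 2 ^ K / fact K * (1200 * (\<epsilon> K)\<^sup>2)"
      using Bk[of K] by linarith
    also have "\<dots> = 2 ^ K / fact K * (1 + bad_coeff (real d) K / n + 1200 * (\<epsilon> K)\<^sup>2)"
      by (simp only: distrib_left)
    also have "\<dots> \<le> 2 ^ K / fact K * (8 * (real d + 1) * (real K + 1)\<^sup>2)"
    proof (intro mult_left_mono)
      define H where "H = (real d + 1) * (real K + 1)\<^sup>2"
      have "1 * 1 \<le> H" unfolding H_def by (intro mult_mono one_le_power) auto
      moreover have "\<bar>1 + bad_coeff (real d) K / n\<bar> \<le> 3 * H"
        using coeff[of K] by (simp only: H_def mult.assoc)
      ultimately have "1 + bad_coeff (real d) K / n + 1200 * (\<epsilon> K)\<^sup>2 \<le> 8 * H" using e by linarith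
      then show "1 + bad_coeff (real d) K / n + 1200 * (\<epsilon> K)\<^sup>2 \<le> 8 * (real d + 1) * (real K + 1)\<^sup>2"
        by (simp only: H_def mult.assoc)
    qed simp
    also have "\<dots> = 8 * (real d + 1) * (2 ^ K / fact K * (real K + 1)\<^sup>2)" by simp
    also have "\<dots> \<le> 8 * (real d + 1) * (\<Gamma> / (real K + 1) ^ 4)"
      using small[of K] divide_right_mono[OF gK[of K], of "(real K + 1) ^ 4"] by (intro mult_left_mono) auto
    finally show ?thesis by simp
  qed
  have bonf: "\<bar>real (card {p. p permutes A \<and> bad p = {}}) / fact (card A) - (\<Sum>k<K. (- 1) ^ k * ?B k)\<bar> \<le> ?B K"
  proof -
    have "real (card {p. p permutes A \<and> bad p = {}}) / fact (card A) - (\<Sum>k<K. (- 1) ^ k * ?B k)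
      = (real (card {p. p permutes A \<and> bad p = {}}) - (\<Sum>k<K. (- 1) ^ k * real (M k))) / fact (card A)"
      by (simp add: diff_divide_distrib sum_divide_distrib)
    then show ?thesis using bonferroni_bad[OF K(1)] by (simp add: divide_right_mono)
  qed
  have "11 * (real d + 1) * \<Gamma> / (real K + 1) ^ 4
      = 8 * (real d + 1) * \<Gamma> / (real K + 1) ^ 4 + 3 * (real d + 1) * \<Gamma> / (real K + 1) ^ 4"
    by (simp flip: add_divide_distrib distrib_right)
  then show ?thesis using bonf last middle tail by linarith
qed

text \<open>The bound of \<open>good_estimate\<close> after \<open>1 / (K + 1) ^ 4\<close> has been
  replaced by \<open>(8 * (d + 1)) ^ 4 / n\<^sup>2\<close>.\<close>

definition error_const :: "nat \<Rightarrow> real" where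
  "error_const d = (1200 * (real d + 1) ^ 4 + 11 * (real d + 1) * (8 * (real d + 1)) ^ 4)
     * (\<Sum>k. 2 ^ k * (real k + 1) ^ 6 / fact k)"

lemma (in successor) good_asymptotics:
  fixes d :: nat
  assumes cD: "card D + d = card A" and cD2: "card D2 + 2 * d = card A"
    and n: "64 * (d + 1)\<^sup>2 \<le> card A"
  shows "\<bar>real (card {p. p permutes A \<and> bad p = {}}) / fact (card A)
           - exp (- 2) * (1 + 4 * (real d - 1) / real (card A))\<bar>
     \<le> error_const d / (real (card A))\<^sup>2"
proof -
  define n where "n = real (card A)"
  define c where "c = real d + 1"
  \<comment> \<open>The largest value of \<open>K + 1\<close> that \<open>good_estimate\<close>
    permits. The lower bound on \<open>n\<close> makes it at least 2, so rounding down loses at most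
    a factor 2, whence the 8 in \<open>error_const\<close>.\<close>
  define x where "x = sqrt n / (4 * c)"
  define q where "q = nat \<lfloor>x\<rfloor>"
  have c: "1 \<le> c" by (simp add: c_def)
  have "real (64 * (d + 1)\<^sup>2) \<le> n" unfolding n_def using n by (rule of_nat_mono)
  moreover have "real (64 * (d + 1)\<^sup>2) = 64 * c\<^sup>2" by (simp add: c_def add.commute)
  ultimately have "(8 * c)\<^sup>2 \<le> n" by (simp add: power_mult_distrib)
  then have "8 * c \<le> sqrt n" by (rule real_le_rsqrt)
  then have x2: "2 \<le> x" using c by (simp add: x_def le_divide_eq)
  have q: "real q \<le> x" "x - 1 < real q" using x2 unfolding q_def by linarith+
  have q2: "2 \<le> q" using x2 by (simp add: q_def le_nat_floor)
  have n0: "0 < n" using card_A by (simp add: n_def)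
  define K where "K = q - 1"
  have K: "0 < K" "real K + 1 = real q" using q2 by (simp_all add: K_def)
  have "16 * (c * real q)\<^sup>2 \<le> 16 * (c * x)\<^sup>2"
    using q c by (intro mult_left_mono power_mono) auto
  also have "\<dots> = n" using c n0 by (simp add: x_def power_divide power_mult_distrib)
  finally have K2: "16 * ((real d + 1) * (real K + 1))\<^sup>2 \<le> real (card A)"
    by (simp add: K c_def n_def)
  define \<Gamma> where "\<Gamma> = (\<Sum>k. 2 ^ k * (real k + 1) ^ 6 / fact k :: real)"
  have \<Gamma>0: "0 \<le> \<Gamma>" unfolding \<Gamma>_def by (intro suminf_nonneg summable_majorant) simp
  have est: "\<bar>real (card {p. p permutes A \<and> bad p = {}}) / fact (card A) - exp (- 2) * (1 + 4 * (real d - 1) / n)\<bar>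
     \<le> 1200 * c ^ 4 * \<Gamma> / n\<^sup>2 + 11 * c * \<Gamma> / real q ^ 4"
    using good_estimate[OF cD cD2 K(1) K2] unfolding K(2) c_def n_def \<Gamma>_def .
  have "x / 2 \<le> real q" using q x2 by linarith
  then have "(x / 2) ^ 4 \<le> real q ^ 4" using x2 by (intro power_mono) auto
  moreover have "(x / 2) ^ 4 = n\<^sup>2 / (8 * c) ^ 4"
  proof -
    have "sqrt n ^ 4 = (sqrt n ^ 2) ^ 2" by (simp only: power_mult[symmetric]) simp
    then have "sqrt n ^ 4 = n\<^sup>2" using n0 by simp
    moreover have "x / 2 = sqrt n / (8 * c)" by (simp add: x_def)
    ultimately show ?thesis by (simp only: power_divide)
  qed
  ultimately have "11 * c * \<Gamma> / real q ^ 4 \<le> 11 * c * \<Gamma> / (n\<^sup>2 / (8 * c) ^ 4)"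
    using c \<Gamma>0 n0 q2 by (intro divide_left_mono) auto
  also have "\<dots> = 11 * c * \<Gamma> * (8 * c) ^ 4 / n\<^sup>2" by simp
  finally have "1200 * c ^ 4 * \<Gamma> / n\<^sup>2 + 11 * c * \<Gamma> / real q ^ 4
      \<le> 1200 * c ^ 4 * \<Gamma> / n\<^sup>2 + 11 * c * \<Gamma> * (8 * c) ^ 4 / n\<^sup>2" by simp
  also have "\<dots> = error_const d / n\<^sup>2"
  proof -
    have "error_const d = 1200 * c ^ 4 * \<Gamma> + 11 * c * \<Gamma> * (8 * c) ^ 4"
      unfolding error_const_def c_def[symmetric] \<Gamma>_def[symmetric] by (simp add: algebra_simps)
    then show ?thesis by (simp only: add_divide_distrib)
  qed
  finally show ?thesis using est unfolding n_def by linarith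
qed

section \<open>The shift graph, the cyclic graph and the final estimate\<close>

text \<open>No cycles exist at all: the shift leads out of \<open>S\<close> from its
  maximum.\<close>

lemma successor_shift:
  fixes d n :: nat
  assumes "1 \<le> d" "4 \<le> n"
  shows "successor {1..n} {1..n - d} (\<lambda>i. i + d)"
proof
  fix S assume S: "S \<subseteq> {1..n - d}" "S \<noteq> {}"
  have fin: "finite S" by (rule finite_subset[OF S(1)]) simp
  have "\<not> Max S + d \<le> Max S" using assms(1) by simp
  then have "Max S + d \<notin> S" using Max_ge[OF fin] by blast
  then show "\<exists>x\<in>S. x + d \<notin> S" using Max_in[OF fin S(2)] by blast
next
  show "x + d \<in> {1..n}" if "x \<in> {1..n - d}" for x using that by auto
qed (use assms in simp_all)

text \<open>A nonempty closed set climbs from any element up to \<open>n\<close>, wraps around to 1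
  and then contains everything.\<close>

lemma successor_cyclic:
  assumes "4 \<le> n"
  shows "successor {1..n} {1..n} (cyc_next n)"
proof
  show "inj_on (cyc_next n) {1..n}" by (auto simp: inj_on_def cyc_next_def split: if_splits)
  show "cyc_next n x \<in> {1..n}" if "x \<in> {1..n}" for x using that by (auto simp: cyc_next_def)
  fix S assume S: "S \<subseteq> {1..n}" "S \<noteq> {}" "S \<noteq> {1..n}"
  show "\<exists>x\<in>S. cyc_next n x \<notin> S"
  proof (rule ccontr)
    assume "\<not> (\<exists>x\<in>S. cyc_next n x \<notin> S)"
    then have closed: "cyc_next n x \<in> S" if "x \<in> S" for x using that by blast
    have up: "y \<in> S" if "x \<in> S" "x \<le> y" "y \<le> n" for x y
      using that(2,1,3)
    proof (induction y rule: dec_induct)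
      case (step m)
      then show ?case using closed[of m] by (simp add: cyc_next_def)
    qed simp
    obtain x where x: "x \<in> S" using S by blast
    then have "n \<in> S" using up[OF x, of n] S by auto
    then have "1 \<in> S" using closed[of n] by (simp add: cyc_next_def)
    then have "{1..n} \<subseteq> S" using up[of 1] by auto
    with S show False by blast
  qed
qed (use assms in auto)

text \<open>The number \<open>y - x - 1\<close> lies between \<open>- n\<close> and
  \<open>n - 2\<close>, so 0 and \<open>- n\<close> are the only multiples of \<open>n\<close> it
  can be; the latter is the step from \<open>n\<close> to 1.\<close>

lemma cong_diff_1_iff:
  assumes "x \<in> {1..n}" "y \<in> {1..n}"
  shows "[int y - int x = 1] (mod int n) \<longleftrightarrow> y = cyc_next n x"
proof
  assume "[int y - int x = 1] (mod int n)"
  then have "int n dvd int y - int x - 1" by (simp add: cong_iff_dvd_diff)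
  then obtain j where j: "int y - int x - 1 = int n * j" by blast
  have n0: "0 < int n" using assms by auto
  have "int n * j < int n * 1" "int n * (- 2) < int n * j" using assms unfolding j[symmetric] by auto
  then have "j < 1" "- 2 < j" using n0 by (simp_all only: mult_less_cancel_left_pos)
  then have "j = 0 \<or> j = - 1" by auto
  then show "y = cyc_next n x" using j assms by (auto simp: cyc_next_def)
next
  assume "y = cyc_next n x"
  then show "[int y - int x = 1] (mod int n)"
    by (auto simp: cyc_next_def cong_iff_dvd_diff)
qed

lemma (in successor) bad_iff:
  assumes "p permutes A" "e \<in> D"
  shows "e \<in> bad p \<longleftrightarrow> (p e \<in> D \<and> p (s e) = s (p e)) \<or> (p (s e) \<in> D \<and> p e = s (p (s e)))"
  using assms(2) by (auto simp: bad_def E_def image_iff doubleton_eq_iff)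

lemma a0_eq:
  assumes "4 \<le> n"
  shows "a0 n = card {p. p permutes {1..n} \<and> successor.bad {1..n} (cyc_next n) p = {}}"
proof -
  interpret successor "{1..n}" "{1..n}" "cyc_next n" using assms by (rule successor_cyclic)
  have "(\<forall>i\<in>{1..n}. \<not> [int (p (cyc_next n i)) - int (p i) = 1] (mod int n) \<and>
                  \<not> [int (p (cyc_next n i)) - int (p i) = -1] (mod int n)) \<longleftrightarrow> bad p = {}"
    if p: "p permutes {1..n}" for p
  proof -
    have "i \<notin> bad p \<longleftrightarrow> \<not> [int (p (cyc_next n i)) - int (p i) = 1] (mod int n) \<and>
                  \<not> [int (p (cyc_next n i)) - int (p i) = -1] (mod int n)" if i: "i \<in> {1..n}" for i
    proof -
      have pi: "p i \<in> {1..n}" "p (cyc_next n i) \<in> {1..n}"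
        using permutes_in_image[OF p] s_in[OF i] i by blast+
      have "[int (p (cyc_next n i)) - int (p i) = -1] (mod int n)
          \<longleftrightarrow> [int (p i) - int (p (cyc_next n i)) = 1] (mod int n)"
        using cong_minus_minus_iff[of "int (p (cyc_next n i)) - int (p i)" "-1" "int n"] by simp
      then show ?thesis
        using bad_iff[OF p i] cong_diff_1_iff[OF pi] cong_diff_1_iff[OF pi(2,1)] pi by blast
    qed
    moreover have "bad p \<subseteq> {1..n}" unfolding bad_def by blast
    ultimately show ?thesis by blast
  qed
  then show ?thesis unfolding a0_def by (intro arg_cong[where f = card] Collect_cong conj_cong refl)
qed

lemma abs_diff_eq_iff:
  fixes x y d n :: nat
  assumes "x \<in> {1..n}" "y \<in> {1..n}"
  shows "\<bar>int y - int x\<bar> = int d \<longleftrightarrow> (x \<in> {1..n - d} \<and> y = x + d) \<or> (y \<in> {1..n - d} \<and> x = y + d)"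
proof -
  have "\<bar>int y - int x\<bar> = int d \<longleftrightarrow> y = x + d \<or> x = y + d" by linarith
  then show ?thesis using assms by auto
qed

lemma ad_eq:
  assumes "4 \<le> n" "1 \<le> d"
  shows "ad d n = card {p. p permutes {1..n} \<and> successor.bad {1..n - d} (\<lambda>i. i + d) p = {}}"
proof -
  interpret successor "{1..n}" "{1..n - d}" "\<lambda>i. i + d" using assms by (intro successor_shift)
  have "(\<forall>i. 1 \<le> i \<and> i + d \<le> n \<longrightarrow> \<bar>int (p (i + d)) - int (p i)\<bar> \<noteq> int d) \<longleftrightarrow> bad p = {}"
    if p: "p permutes {1..n}" for p
  proof -
    have "i \<notin> bad p \<longleftrightarrow> \<bar>int (p (i + d)) - int (p i)\<bar> \<noteq> int d" if i: "i \<in> {1..n - d}" for i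
    proof -
      have "i \<in> {1..n}" "i + d \<in> {1..n}" using i by auto
      then have pi: "p i \<in> {1..n}" "p (i + d) \<in> {1..n}"
        using permutes_in_image[OF p] by blast+
      show ?thesis unfolding bad_iff[OF p i] abs_diff_eq_iff[OF pi] by simp
    qed
    moreover have "bad p \<subseteq> {1..n - d}" unfolding bad_def by blast
    moreover have "1 \<le> i \<and> i + d \<le> n \<longleftrightarrow> i \<in> {1..n - d}" for i using assms by auto
    ultimately show ?thesis by blast
  qed
  then show ?thesis unfolding ad_def by (intro arg_cong[where f = card] Collect_cong conj_cong refl)
qed

lemma a_estimate:
  assumes n: "64 * (d + 1)\<^sup>2 \<le> n"
  shows "\<bar>real (a n d) / fact n - exp (- 2) * (1 + 4 * (real d - 1) / real n)\<bar> \<le> error_const d / (real n)\<^sup>2"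
proof -
  have d1: "d + 1 \<le> (d + 1)\<^sup>2" by (simp add: power2_eq_square)
  then have n4: "4 \<le> n" and nd: "2 * d \<le> n" using n by linarith+
  show ?thesis
  proof (cases "d = 0")
    case True
    interpret successor "{1..n}" "{1..n}" "cyc_next n" using n4 by (rule successor_cyclic)
    \<comment> \<open>On the cycle every vertex starts an edge and a path of two edges, so both
      counts fit the general form with \<open>d = 0\<close>.\<close>
    have "D2 = {1..n}" unfolding D2_def using s_in by blast
    then show ?thesis
      using good_asymptotics[of 0] n True a0_eq[OF n4] by (simp add: a_def)
  next
    case False
    then have d: "1 \<le> d" by simp
    interpret successor "{1..n}" "{1..n - d}" "\<lambda>i. i + d" using d n4 by (rule successor_shift)
    \<comment> \<open>Because \<open>2 * d \<le> n\<close>, the truncated subtraction is exact and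
      the set has \<open>n - 2 * d\<close> elements.\<close>
    have "D2 = {1..n - 2 * d}" unfolding D2_def using d by auto
    then show ?thesis
      using good_asymptotics[of d] n nd d ad_eq[OF n4 d] by (simp add: a_def)
  qed
qed

theorem mainTheorem3:
  fixes d :: nat
  shows "(\<lambda>n. real (a n d) / fact n - exp (-2) * (1 + 4 * (real d - 1) / real n))
           \<in> O(\<lambda>n. 1 / real n ^ 2)
         \<and> (\<lambda>n. real (a n d) / fact n) \<longlonglongrightarrow> exp (-2)"
proof
  let ?e = "\<lambda>n. real (a n d) / fact n - exp (-2) * (1 + 4 * (real d - 1) / real n)"
  have bound: "\<forall>\<^sub>F n in sequentially. norm (?e n) \<le> error_const d * (1 / real n ^ 2)"
    using eventually_ge_at_top[of "64 * (d + 1)\<^sup>2"]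
    by eventually_elim (use a_estimate[of d] in simp)
  then show "?e \<in> O(\<lambda>n. 1 / real n ^ 2)"
    by (intro bigoI[of _ "error_const d"]) simp
  have "(\<lambda>n. error_const d * (1 / real n ^ 2)) \<longlonglongrightarrow> error_const d * 0"
    by (intro tendsto_mult tendsto_const) (use lim_inverse_n'[THEN tendsto_power, of 2] in \<open>simp add: power_divide\<close>)
  then have "?e \<longlonglongrightarrow> 0"
    using Lim_null_comparison[OF bound] by simp
  moreover have "(\<lambda>n. exp (-2) * (1 + 4 * (real d - 1) / real n)) \<longlonglongrightarrow> exp (-2) * (1 + 0)"
    by (intro tendsto_mult tendsto_add tendsto_const lim_const_over_n)
  ultimately have "(\<lambda>n. ?e n + exp (-2) * (1 + 4 * (real d - 1) / real n)) \<longlonglongrightarrow> 0 + exp (-2) * (1 + 0)"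
    by (rule tendsto_add)
  then show "(\<lambda>n. real (a n d) / fact n) \<longlonglongrightarrow> exp (-2)" by simp
qed

end
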